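(* Let $M^5=S^2\times i\,\mathbb{R}^3\subset\mathbb{C}^3$ be a real-analytic tube hypersurface, with base a real-analytic surface $S^2\subset\mathbb{R}^3$, which is everywhere $2$-nondegenerate and of constant Levi rank $1$. Then the following two conditions are equivalent. (i) The base surface $S^2$ is locally equivalent within $\mathbb{R}^3$, under the $12$-dimensional real affine group $\mathrm{Aff}_3(\mathbb{R})$, to the surface $\big\{u=\frac{x^2}{1-y}\big\}$. (ii) $M^5$ is locally equivalent within $\mathbb{C}^3$, under local biholomorphisms of $\mathbb{C}^3$, to the hypersurface $\big\{\operatorname{Re} w=\frac{(\operatorname{Re} z)^2}{1-\operatorname{Re}\zeta}\big\}$.
   Context: Coordinates on $\mathbb{R}^3$ are $(x,y,u)$; coordinates on $\mathbb{C}^3$ are $(z,\zeta,w)$ with $x=\operatorname{Re} z$, $y=\operatorname{Re}\zeta$, $u=\operatorname{Re} w$. A tube hypersurface is $M=S\times i\,\mathbb{R}^3=\{\mathbf z\in\mathbb{C}^3:\operatorname{Re}\mathbf z\in S\}$ with $S\subset\mathbb{R}^3$ a surface. $\mathrm{Aff}_3(\mathbb{R})$ is the group of maps $\mathbf x\mapsto A\mathbf x+b$ with $A\in \mathrm{GL}_3(\mathbb{R})$, $b\in\mathbb{R}^3$. Nondegeneracy hypotheses: near each of its points, and after a real affine change of coordinates if necessary, $S$ is a graph $u=F(x,y)$ (so that $M$ is $\operatorname{Re} w=F(\operatorname{Re} z,\operatorname{Re}\zeta)$) with $F$ real-analytic. "Constant Levi rank $1$" means $F_{xx}\neq0$ everywhere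 and $F_{xx}F_{yy}-(F_{xy})^2\equiv 0$. "$2$-nondegenerate" means $F_{xx}F_{xxy}-F_{xy}F_{xxx}\neq 0$ everywhere. All equivalences are local: a submanifold is locally equivalent to the model under a given class of transformations if each of its points has an open neighbourhood in it which is mapped by some transformation of this class (in the biholomorphic case: a biholomorphic map between open subsets of $\mathbb{C}^3$) onto an open subset of the model. *)

theory Defs
  imports "HOL-Analysis.Analysis"
begin

definition real_analytic2_on :: "(real \<Rightarrow> real \<Rightarrow> real) \<Rightarrow> (real \<times> real) set \<Rightarrow> bool" where
  "real_analytic2_on F D \<longleftrightarrow>
     (\<forall>(a, b)\<in>D. \<exists>c :: nat \<Rightarrow> nat \<Rightarrow> real. \<exists>r>0. \<forall>x y. \<bar>x - a\<bar> < r \<longrightarrow> \<bar>y - b\<bar> < r \<longrightarrow>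
        ((\<lambda>(j, k). c j k * (x - a) ^ j * (y - b) ^ k) has_sum F x y) UNIV)"

definition dx :: "(real \<Rightarrow> real \<Rightarrow> real) \<Rightarrow> real \<Rightarrow> real \<Rightarrow> real" where
  "dx F x y = deriv (\<lambda>t. F t y) x"

definition dy :: "(real \<Rightarrow> real \<Rightarrow> real) \<Rightarrow> real \<Rightarrow> real \<Rightarrow> real" where
  "dy F x y = deriv (\<lambda>t. F x t) y"

text \<open>In the next two predicates, \<open>F\<close> is the graphing function of the tube hypersurface
  \<open>Re w = F (Re z) (Re \<zeta>)\<close>, where \<open>(Re z, Re \<zeta>)\<close> ranges over \<open>D\<close>.\<close>

definition constant_Levi_rank_1 :: "(real \<Rightarrow> real \<Rightarrow> real) \<Rightarrow> (real \<times> real) set \<Rightarrow> bool" where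
  "constant_Levi_rank_1 F D \<longleftrightarrow>
     (\<forall>(x, y)\<in>D. dx (dx F) x y \<noteq> 0 \<and>
        dx (dx F) x y * dy (dy F) x y - (dy (dx F) x y)\<^sup>2 = 0)"

definition two_nondegenerate :: "(real \<Rightarrow> real \<Rightarrow> real) \<Rightarrow> (real \<times> real) set \<Rightarrow> bool" where
  "two_nondegenerate F D \<longleftrightarrow>
     (\<forall>(x, y)\<in>D. dx (dx F) x y * dy (dx (dx F)) x y - dy (dx F) x y * dx (dx (dx F)) x y \<noteq> 0)"

definition Aff3 :: "(real^3 \<Rightarrow> real^3) set" where
  "Aff3 = {\<lambda>x. A *v x + b | A b. invertible A}"

definition graph_over :: "(real \<Rightarrow> real \<Rightarrow> real) \<Rightarrow> (real \<times> real) set \<Rightarrow> (real^3) set" where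
  "graph_over F D = {vector [x, y, F x y] | x y. (x, y) \<in> D}"

text \<open>The affine coordinate change is part of the definition because \<open>F\<^sub>x\<^sub>x \<noteq> 0\<close> depends on the choice
  of affine coordinates. Both nondegeneracy conditions refer to the same local graph.\<close>

definition nondegenerate_analytic_surface :: "(real^3) set \<Rightarrow> bool" where
  "nondegenerate_analytic_surface S \<longleftrightarrow>
     (\<forall>p\<in>S. \<exists>T\<in>Aff3. \<exists>W D F. open W \<and> p \<in> W \<and> open D \<and> real_analytic2_on F D \<and>
        T ` (S \<inter> W) = graph_over F D \<and> constant_Levi_rank_1 F D \<and> two_nondegenerate F D)"

definition tube :: "(real^3) set \<Rightarrow> (complex^3) set" where
  "tube S = {z. (\<chi> i. Re (z $ i)) \<in> S}"

definition holomorphic3_on :: "(complex^3 \<Rightarrow> complex^3) \<Rightarrow> (complex^3) set \<Rightarrow> bool" where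
  "holomorphic3_on f U \<longleftrightarrow>
     (\<forall>z\<in>U. \<exists>J :: complex^3^3. (f has_derivative (\<lambda>h. J *v h)) (at z))"

definition biholomorphic3 :: "(complex^3) set \<Rightarrow> (complex^3) set \<Rightarrow> (complex^3 \<Rightarrow> complex^3) \<Rightarrow> bool" where
  "biholomorphic3 U V f \<longleftrightarrow> open U \<and> open V \<and> bij_betw f U V \<and>
     holomorphic3_on f U \<and> holomorphic3_on (inv_into U f) V"

text \<open>A class of local transformations is a set of pairs \<open>(U, f)\<close> of a domain and a map
  whose values outside \<open>U\<close> are irrelevant.\<close>

definition locally_equivalent ::
  "('a::topological_space set \<times> ('a \<Rightarrow> 'a)) set \<Rightarrow> 'a set \<Rightarrow> 'a set \<Rightarrow> bool" where
  "locally_equivalent \<T> M N \<longleftrightarrow>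
     (\<forall>p\<in>M. \<exists>X. openin (top_of_set M) X \<and> p \<in> X \<and>
        (\<exists>(U, f)\<in>\<T>. X \<subseteq> U \<and> openin (top_of_set N) (f ` X)))"

definition affine_transformations :: "((real^3) set \<times> (real^3 \<Rightarrow> real^3)) set" where
  "affine_transformations = {UNIV} \<times> Aff3"

definition local_biholomorphisms :: "((complex^3) set \<times> (complex^3 \<Rightarrow> complex^3)) set" where
  "local_biholomorphisms = {(U, f). \<exists>V. biholomorphic3 U V f}"

text \<open>Since \<open>x / 0 = 0\<close>, the points at which the denominator vanishes have to be excluded explicitly.\<close>

definition model_surface :: "(real^3) set" where
  "model_surface = {p. p $ 2 \<noteq> 1 \<and> p $ 3 = (p $ 1)\<^sup>2 / (1 - p $ 2)}"

definition model_hypersurface :: "(complex^3) set" where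
  "model_hypersurface =
     {p. Re (p $ 2) \<noteq> 1 \<and> Re (p $ 3) = (Re (p $ 1))\<^sup>2 / (1 - Re (p $ 2))}"

end

theory Submission
  imports Defs "HOL-Complex_Analysis.Conformal_Mappings"
begin

text \<open>
  For the implication from (ii) to (i): in the coordinates \<open>Z = (1 - \<zeta>, z, w)\<close>, read as a symmetric \<open>2 \<times> 2\<close> matrix,
  the model is the set where \<open>Re Z\<close> is singular with nonzero upper left entry.  A local equivalence \<open>F\<close>
  carries the imaginary translations of the tube to three commuting holomorphic vector fields
  \<open>Y\<^sub>b\<close> tangent to the model.  Since the model is foliated by complex lines in null directions,
  tangency forces each \<open>Y\<^sub>b\<close> to be a conformal Killing field of \<open>det\<close>; together with
  commutativity this gives \<open>D\<^sub>a Y\<^sub>b = Y\<^sub>b K a + a K Y\<^sub>b\<close> for one symmetric matrix function \<open>K\<close>, which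
  then satisfies \<open>D\<^sub>a K = - K a K\<close>.  Hence \<open>Y\<^sub>b = (1 + W K\<^sub>0) L\<^sub>b (1 + K\<^sub>0 W)\<close> with \<open>W = Z - Z\<^sub>*\<close>.  The base
  point \<open>Z\<^sub>*\<close> can be chosen purely imaginary, and tangency then makes all \<open>L\<^sub>b\<close> real and
  \<open>K\<^sub>0\<close> imaginary.  The map \<open>W (1 + K\<^sub>0 W)\<^sup>-\<^sup>1\<close> preserves singularity of the real part and turns \<open>Y\<^sub>b\<close> into the
  constant \<open>L\<^sub>b\<close>, so after composition with it \<open>F\<close> is affine with real linear part.
\<close>

section \<open>Holomorphic functions of several complex variables\<close>

text \<open>From (i) to (ii), an affine map with real matrix is simply extended to complex vectors.
  In the other direction the fields \<open>Y_b\<close> are constrained only on a real hypersurface,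
  while differential equations are wanted on an open set. The null parameter \<open>p\<close>
  bridges the gap: for fixed \<open>p\<close>, tangency makes a holomorphic function vanish on part
  of a translate of \<open>i R^3\<close>, hence on an open set; letting \<open>p\<close> vary then
  gives a polynomial identity in \<open>p\<close>, whose coefficients are separate equations. A
  purely imaginary base point lies over the apex of the cone. A cone point has one null vector up to
  scaling, so tangency there sees a single value of the quadratic form of \<open>Y_b\<close>; over
  the apex every \<open>p\<close> is available and the whole matrix becomes real. The fields are
  polynomial, so they can be evaluated there even outside the neighbourhood on which they were
  found. The straightening map is read off from the fields: its inverse
  \<open>C (1 - K_0 C)^-1\<close> carries the constant field \<open>L\<close> to
  \<open>(1 + W K_0) L (1 + K_0 W)\<close>.\<close>

definition holo :: "(complex^'n \<Rightarrow> complex) \<Rightarrow> (complex^'n) set \<Rightarrow> bool" where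
  "holo g V \<longleftrightarrow> (\<forall>z\<in>V. \<exists>a. (g has_derivative (\<lambda>h. \<Sum>i\<in>UNIV. a i * h $ i)) (at z))"

text \<open>\<open>frechet_derivative\<close> is a choice operator, so the value has its usual
  meaning only at points of differentiability.\<close>

definition pd :: "'n \<Rightarrow> (complex^'n \<Rightarrow> complex) \<Rightarrow> complex^'n \<Rightarrow> complex" where
  "pd i g z = frechet_derivative g (at z) (axis i 1)"

lemma pd_eq:
  assumes "(g has_derivative (\<lambda>h. \<Sum>i\<in>UNIV. a i * h $ i)) (at z)"
  shows "pd j g z = a j"
  using assms by (simp add: pd_def frechet_derivative_at[OF assms, symmetric] axis_def if_distrib cong: if_cong)

lemma holo_has_derivative:
  assumes "holo g V" "z \<in> V"
  shows "(g has_derivative (\<lambda>h. \<Sum>i\<in>UNIV. pd i g z * h $ i)) (at z)"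
proof -
  obtain a where a: "(g has_derivative (\<lambda>h. \<Sum>i\<in>UNIV. a i * h $ i)) (at z)"
    using assms by (auto simp: holo_def)
  have "(\<lambda>i. pd i g z) = a" using pd_eq[OF a] by auto
  then show ?thesis using a by (metis (no_types, lifting) ext)
qed

lemma holoI:
  assumes "\<And>z. z \<in> V \<Longrightarrow> (g has_derivative (\<lambda>h. \<Sum>i\<in>UNIV. a z i * h $ i)) (at z)"
  shows "holo g V"
  using assms unfolding holo_def by blast

lemma holo_subset: "holo g V \<Longrightarrow> U \<subseteq> V \<Longrightarrow> holo g U"
  by (auto simp: holo_def)

lemma holo_continuous_on: "holo g V \<Longrightarrow> continuous_on V g"
  by (meson continuous_at_imp_continuous_on has_derivative_continuous holo_has_derivative)

lemma bounded_linear_vector_scalar: "bounded_linear (\<lambda>s. s *s (v :: complex^'n))"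
  by (subst linear_conv_bounded_linear[symmetric])
    (auto intro!: linearI simp: vec_eq_iff algebra_simps)

lemma continuous_on_from_holo:
  fixes f :: "complex^'n \<Rightarrow> complex^'m"
  assumes "\<And>k. holo (\<lambda>z. f z $ k) U"
  shows "continuous_on U f"
proof -
  have "continuous_on U (\<lambda>z. \<chi> k. f z $ k)"
    by (intro continuous_on_vec_lambda holo_continuous_on assms)
  then show ?thesis by (simp add: vec_lambda_eta)
qed

section \<open>Cauchy integrals and smoothness in several variables\<close>

lemma holo_along:
  assumes "holo g V" "z + t *s v \<in> V"
  shows "((\<lambda>s. g (z + s *s v)) has_field_derivative (\<Sum>i\<in>UNIV. pd i g (z + t *s v) * v $ i)) (at t)"
proof -
  have "((\<lambda>s. z + s *s v) has_derivative (\<lambda>s. s *s v)) (at t)"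
    by (auto intro!: derivative_eq_intros bounded_linear_imp_has_derivative bounded_linear_vector_scalar)
  from has_derivative_compose[OF this holo_has_derivative[OF assms]]
  show ?thesis
    by (simp add: has_field_derivative_def sum_distrib_left[symmetric] mult_ac)
      (metis (no_types, lifting) ext mult.commute)
qed

lemma holo_along_axis:
  assumes "holo g V" "z + axis j t \<in> V"
  shows "((\<lambda>s. g (z + axis j s)) has_field_derivative pd j g (z + axis j t)) (at t)"
proof -
  have *: "s *s axis j 1 = axis j s" for s :: complex
    by (simp add: vec_eq_iff axis_def)
  show ?thesis
    using holo_along[of g V z t "axis j 1"] assms unfolding *
    by (simp add: axis_def if_distrib cong: if_cong)
qed

lemma norm_axis: "norm (axis j (t::complex)) = norm t"
  by (simp add: norm_vec_def L2_set_def axis_def if_distrib[of norm] if_distrib[of "\<lambda>x. x^2"] cong: if_cong)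

text \<open>Cauchy's formula for the derivative of a one-variable slice. The velocity of the circle
  is \<open>2 pi i\<close> times its position, which cancels one of the two powers in the
  denominator. The integrand contains \<open>g\<close> but no derivative of it, so regularity in
  \<open>w\<close> can be read off under the integral sign.\<close>

lemma pd_eq_integral:
  fixes g :: "complex^'n \<Rightarrow> complex"
  assumes g: "holo g V" and r: "r > 0" and sub: "\<And>t. norm t \<le> r \<Longrightarrow> w + axis j t \<in> V"
  shows "pd j g w = integral (cbox 0 1)
     (\<lambda>s. g (w + axis j (r * exp (2 * of_real pi * \<i> * of_real s))) / (r * exp (2 * of_real pi * \<i> * of_real s)))"
proof -
  let ?f = "\<lambda>t. g (w + axis j t)"
  have d: "(?f has_field_derivative pd j g (w + axis j t)) (at t)" if "norm t \<le> r" for t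
    using holo_along_axis[OF g sub[OF that]] .
  have c: "continuous_on (cball 0 r) ?f"
    by (rule continuous_at_imp_continuous_on) (auto intro!: DERIV_isCont d)
  have h: "?f holomorphic_on ball 0 r"
    by (rule holomorphic_onI, rule field_differentiable_at_within)
      (auto simp: field_differentiable_def intro!: exI d)
  have "((\<lambda>u. ?f u / (u - 0) ^ Suc 1) has_contour_integral
     (2 * pi * \<i>) / fact 1 * (deriv ^^ 1) ?f 0) (circlepath 0 r)"
    by (rule Cauchy_has_contour_integral_higher_derivative_circlepath[OF c h]) (use r in auto)
  moreover have "deriv ?f 0 = pd j g w"
    using d[of 0] r by (simp add: DERIV_imp_deriv axis_def zero_vec_def[symmetric])
  ultimately have "((\<lambda>u. ?f u / u\<^sup>2) has_contour_integral (2 * pi * \<i>) * pd j g w) (circlepath 0 r)"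
    by (simp add: power2_eq_square)
  then have "((\<lambda>s. ?f (circlepath 0 r s) / (circlepath 0 r s)\<^sup>2 * vector_derivative (circlepath 0 r) (at s))
      has_integral (2 * pi * \<i>) * pd j g w) {0..1}"
    by (simp add: has_contour_integral)
  then have "((\<lambda>s. (2 * pi * \<i>) * (?f (r * exp (2 * of_real pi * \<i> * of_real s)) / (r * exp (2 * of_real pi * \<i> * of_real s))))
      has_integral (2 * pi * \<i>) * pd j g w) {0..1}"
    by (rule has_integral_eq[rotated])
      (use r in \<open>simp only: vector_derivative_circlepath, simp add: circlepath power2_eq_square field_simps\<close>)
  from has_integral_mult_right[OF this, of "1 / (2 * pi * \<i>)"]
  show ?thesis by (simp add: field_simps integral_unique)
qed

text \<open>One radius serves all centres in a ball and all directions, so that the Cauchy integrals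
  form a single parametric integral.\<close>

lemma closed_disc_subset_nbhd:
  fixes V :: "(complex^'n) set"
  assumes "open V" "z \<in> V"
  obtains r where "r > 0" "ball z r \<subseteq> V"
    "\<And>(j::'n) w t. w \<in> ball z r \<Longrightarrow> norm (t::complex) \<le> r \<Longrightarrow> w + axis j t \<in> V"
proof -
  obtain e where e: "e > 0" "ball z e \<subseteq> V" using assms open_contains_ball by blast
  show ?thesis
  proof
    show "e / 2 > 0" "ball z (e / 2) \<subseteq> V" using e by auto
    fix j :: 'n and w and t :: complex assume "w \<in> ball z (e / 2)" "norm t \<le> e / 2"
    then have "dist z w < e / 2" "norm (axis j t) \<le> e / 2" by (auto simp: norm_axis)
    then have "dist z (w + axis j t) < e"
      using dist_triangle[of z "w + axis j t" w] by (simp add: dist_norm)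
    then show "w + axis j t \<in> V" using e by auto
  qed
qed

lemma continuous_on_axis [continuous_intros]:
  fixes f :: "'a::topological_space \<Rightarrow> complex"
  assumes "continuous_on S f"
  shows "continuous_on S (\<lambda>x. axis j (f x))"
  proof -
  have "continuous_on S (\<lambda>x. if i = j then f x else 0)" for i
    using assms by (cases "i = j") auto
  then show ?thesis unfolding axis_def by (intro continuous_on_vec_lambda)
qed

lemma holo_pd_continuous_on:
  fixes g :: "complex^'n \<Rightarrow> complex"
  assumes g: "holo g V" and V: "open V"
  shows "continuous_on V (pd j g)"
proof (rule continuous_at_imp_continuous_on, rule ballI)
  fix z assume "z \<in> V"
  obtain r where r: "r > 0" "ball z r \<subseteq> V"
    and sub: "\<And>(j::'n) w t. w \<in> ball z r \<Longrightarrow> norm (t::complex) \<le> r \<Longrightarrow> w + axis j t \<in> V"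
    using closed_disc_subset_nbhd[OF V \<open>z \<in> V\<close>] by metis
  have "continuous_on (ball z r) (\<lambda>w. integral (cbox 0 1)
     (\<lambda>s. g (w + axis j (r * exp (2 * of_real pi * \<i> * of_real s))) / (r * exp (2 * of_real pi * \<i> * of_real s))))"
    by (rule integral_continuous_on_param, unfold split_beta)
      (intro continuous_intros continuous_on_compose2[OF holo_continuous_on[OF g]],
        use r in \<open>auto intro!: sub simp: norm_mult\<close>)
  then have "continuous_on (ball z r) (pd j g)"
    by (rule continuous_on_cong[THEN iffD1, OF refl, rotated])
      (rule pd_eq_integral[OF g r(1) sub, symmetric], auto)
  then show "isCont (pd j g) z"
    using r by (simp add: continuous_on_eq_continuous_at)
qed

text \<open>A linear form packed as a bounded linear function, the type in which
  \<open>leibniz_rule\<close> expects derivatives.\<close>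

definition linf :: "('n \<Rightarrow> complex) \<Rightarrow> (complex^'n) \<Rightarrow>\<^sub>L complex" where
  "linf a = (\<Sum>i\<in>UNIV. blinfun_mult_right (a i) o\<^sub>L Blinfun (\<lambda>x. x $ i))"

lemma linf_apply: "blinfun_apply (linf a) h = (\<Sum>i\<in>UNIV. a i * h $ i)"
  by (simp add: linf_def blinfun.sum_left bounded_linear_Blinfun_apply bounded_linear_vec_nth)

lemma continuous_on_linf:
  assumes "\<And>i. continuous_on S (\<lambda>x. a x i)"
  shows "continuous_on S (\<lambda>x. linf (a x))"
  unfolding linf_def by (intro continuous_intros bounded_linear.continuous_on[OF bounded_linear_blinfun_mult_right] assms)


text \<open>Differentiation under the integral sign turns the Cauchy integral of \<open>g\<close>
  into those of the \<open>pd i g\<close>. The coefficients stay in integral form because Cauchy's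
  formula, read backwards, identifies them with \<open>pd j (pd i g) z\<close>; this is the symmetry
  of second derivatives.\<close>

lemma pd_has_derivative_integral:
  fixes g :: "complex^'n \<Rightarrow> complex"
  assumes g: "holo g V" and V: "open V" and z: "z \<in> V"
  obtains r where "r > 0" "\<And>t. norm t \<le> r \<Longrightarrow> z + axis j t \<in> V"
    "(pd j g has_derivative (\<lambda>h. \<Sum>i\<in>UNIV. integral (cbox 0 1)
       (\<lambda>s. pd i g (z + axis j (r * exp (2 * of_real pi * \<i> * of_real s))) / (r * exp (2 * of_real pi * \<i> * of_real s))) * h $ i)) (at z)"
proof -
  obtain r where r: "r > 0" "ball z r \<subseteq> V"
    and sub: "\<And>(j::'n) w t. w \<in> ball z r \<Longrightarrow> norm (t::complex) \<le> r \<Longrightarrow> w + axis j t \<in> V"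
    using closed_disc_subset_nbhd[OF V z] by metis
  define e where "e s = r * exp (2 * of_real pi * \<i> * of_real s)" for s :: real
  have ne: "norm (e s) \<le> r" "e s \<noteq> 0" for s using r by (auto simp: e_def norm_mult)
  have ce: "continuous_on A e" for A unfolding e_def by (intro continuous_intros)
  let ?fx = "\<lambda>w s. linf (\<lambda>i. pd i g (w + axis j (e s)) / e s)"
  have cpd: "continuous_on (ball z r \<times> cbox 0 1) (\<lambda>x. pd i g (fst x + axis j (e (snd x))) / e (snd x))" for i
    by (intro continuous_intros continuous_on_compose2[OF holo_pd_continuous_on[OF g V]]
          continuous_on_compose2[OF ce])
        (auto intro!: sub simp: ne)
  have cfx: "continuous_on (ball z r \<times> cbox 0 1) (\<lambda>x. ?fx (fst x) (snd x))"
    by (intro continuous_on_linf cpd)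
  have zin: "z \<in> ball z r" using r by simp
  have der: "((\<lambda>w. integral (cbox 0 1) (\<lambda>s. g (w + axis j (e s)) / e s)) has_derivative
      blinfun_apply (integral (cbox 0 1) (?fx z))) (at z within ball z r)"
  proof (rule leibniz_rule)
    fix w s assume w: "w \<in> ball z r"
    have *: "((\<lambda>w. w + axis j (e s)) has_derivative (\<lambda>h. h)) (at w)"
      by (auto intro!: derivative_eq_intros)
    from has_derivative_compose[OF this holo_has_derivative[OF g sub[OF w ne(1)]]]
    have "((\<lambda>w. g (w + axis j (e s)) / e s) has_derivative blinfun_apply (?fx w s)) (at w)"
      by (auto intro!: derivative_eq_intros simp: linf_apply[abs_def] sum_divide_distrib ne)
    then show "((\<lambda>w. g (w + axis j (e s)) / e s) has_derivative blinfun_apply (?fx w s)) (at w within ball z r)"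
      by (rule has_derivative_at_withinI)
  next
    fix w assume w: "w \<in> ball z r"
    show "(\<lambda>s. g (w + axis j (e s)) / e s) integrable_on cbox 0 1"
      by (intro integrable_continuous continuous_intros ce continuous_on_compose2[OF holo_continuous_on[OF g]])
        (use w in \<open>auto intro!: sub simp: ne\<close>)
  next
    show "continuous_on (ball z r \<times> cbox 0 1) (\<lambda>(w, s). ?fx w s)"
      using cfx by (simp add: split_beta)
  qed (use r in auto)
  have ifx: "?fx z integrable_on cbox 0 1"
    by (intro integrable_continuous continuous_on_compose2[OF cfx, of _ "\<lambda>s. (z, s)", simplified] continuous_intros)
      (use r in auto)
  have ipd: "(\<lambda>s. pd i g (z + axis j (e s)) / e s) integrable_on cbox 0 1" for i
    by (intro integrable_continuous continuous_on_compose2[OF cpd, of _ "\<lambda>s. (z, s)", simplified] continuous_intros)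
      (use r in auto)
  have app: "blinfun_apply (integral (cbox 0 1) (?fx z)) h =
      (\<Sum>i\<in>UNIV. integral (cbox 0 1) (\<lambda>s. pd i g (z + axis j (e s)) / e s) * h $ i)" for h
    unfolding blinfun_apply_integral[OF ifx] linf_apply
    by (subst integral_sum[OF finite]) (simp_all only: integral_mult_left integrable_on_mult_left ipd)
  then have app': "blinfun_apply (integral (cbox 0 1) (?fx z)) =
      (\<lambda>h. \<Sum>i\<in>UNIV. integral (cbox 0 1) (\<lambda>s. pd i g (z + axis j (e s)) / e s) * h $ i)" by (rule ext)
  have eq: "integral (cbox 0 1) (\<lambda>s. g (w + axis j (e s)) / e s) = pd j g w" if "w \<in> ball z r" for w
    unfolding e_def using that by (intro pd_eq_integral[OF g r(1), symmetric] sub) auto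
  have "(pd j g has_derivative (\<lambda>h. \<Sum>i\<in>UNIV. integral (cbox 0 1) (\<lambda>s. pd i g (z + axis j (e s)) / e s) * h $ i)) (at z within ball z r)"
    by (rule has_derivative_transform[OF zin eq[symmetric]]) (use der[unfolded app'] in auto)
  then have "(pd j g has_derivative (\<lambda>h. \<Sum>i\<in>UNIV. integral (cbox 0 1) (\<lambda>s. pd i g (z + axis j (e s)) / e s) * h $ i)) (at z)"
    using at_within_open[OF zin open_ball] by simp
  then show ?thesis using that[of r] r sub[OF zin] unfolding e_def by auto
qed

lemma holo_pd:
  assumes "holo g V" "open V"
  shows "holo (pd j g) V"
  unfolding holo_def
proof
  fix z assume z: "z \<in> V"
  show "\<exists>a. (pd j g has_derivative (\<lambda>h. \<Sum>i\<in>UNIV. a i * h $ i)) (at z)"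
    by (rule pd_has_derivative_integral[OF assms z, of j]) (rule exI, assumption)
qed

lemma pd_commute:
  assumes g: "holo g V" and V: "open V" and z: "z \<in> V"
  shows "pd i (pd j g) z = pd j (pd i g) z"
proof -
  obtain r where r: "r > 0" "\<And>t. norm t \<le> r \<Longrightarrow> z + axis j t \<in> V"
    and d: "(pd j g has_derivative (\<lambda>h. \<Sum>i\<in>UNIV. integral (cbox 0 1)
       (\<lambda>s. pd i g (z + axis j (r * exp (2 * of_real pi * \<i> * of_real s))) / (r * exp (2 * of_real pi * \<i> * of_real s))) * h $ i)) (at z)"
    by (rule pd_has_derivative_integral[OF g V z, of j], rule that)
  show ?thesis
    unfolding pd_eq[OF d] by (rule pd_eq_integral[OF holo_pd[OF g V] r, symmetric])
qed

section \<open>Differentiation rules\<close>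

lemma pd_add:
  assumes "holo f V" "holo g V" "z \<in> V"
  shows "pd j (\<lambda>z. f z + g z) z = pd j f z + pd j g z"
  by (rule pd_eq[where a = "\<lambda>i. pd i f z + pd i g z"])
    (use has_derivative_add[OF holo_has_derivative[OF assms(1,3)] holo_has_derivative[OF assms(2,3)]]
      in \<open>simp add: sum.distrib algebra_simps\<close>)

lemma holo_add [intro]: "holo f V \<Longrightarrow> holo g V \<Longrightarrow> holo (\<lambda>z. f z + g z) V"
  by (rule holoI[where a = "\<lambda>z i. pd i f z + pd i g z"])
    (use has_derivative_add[OF holo_has_derivative holo_has_derivative]
      in \<open>fastforce simp: sum.distrib algebra_simps\<close>)

lemma pd_diff:
  assumes "holo f V" "holo g V" "z \<in> V"
  shows "pd j (\<lambda>z. f z - g z) z = pd j f z - pd j g z"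
  by (rule pd_eq[where a = "\<lambda>i. pd i f z - pd i g z"])
    (use has_derivative_diff[OF holo_has_derivative[OF assms(1,3)] holo_has_derivative[OF assms(2,3)]]
      in \<open>simp add: sum_subtractf algebra_simps\<close>)

lemma holo_diff [intro]: "holo f V \<Longrightarrow> holo g V \<Longrightarrow> holo (\<lambda>z. f z - g z) V"
  by (rule holoI[where a = "\<lambda>z i. pd i f z - pd i g z"])
    (use has_derivative_diff[OF holo_has_derivative holo_has_derivative]
      in \<open>fastforce simp: sum_subtractf algebra_simps\<close>)

lemma mult_has_derivative:
  assumes "holo f V" "holo g V" "z \<in> V"
  shows "((\<lambda>z. f z * g z) has_derivative (\<lambda>h. \<Sum>i\<in>UNIV. (pd i f z * g z + f z * pd i g z) * h $ i)) (at z)"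
  using has_derivative_mult[OF holo_has_derivative[OF assms(1,3)] holo_has_derivative[OF assms(2,3)]]
  by (simp add: sum.distrib sum_distrib_left sum_distrib_right algebra_simps)

lemmas pd_mult = pd_eq[OF mult_has_derivative]

lemma holo_mult [intro]: "holo f V \<Longrightarrow> holo g V \<Longrightarrow> holo (\<lambda>z. f z * g z) V"
  by (rule holoI, rule mult_has_derivative)

lemma const_has_derivative:
  "((\<lambda>z::complex^'n. c::complex) has_derivative (\<lambda>h. \<Sum>i\<in>UNIV. (\<lambda>i. 0) i * h $ i)) (at z)"
  by simp

lemma pd_const [simp]: "pd j (\<lambda>z. c) z = 0"
  by (rule pd_eq[OF const_has_derivative])

lemma holo_const [intro]: "holo (\<lambda>z. c) V"
  by (rule holoI, rule const_has_derivative)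

lemma holo_cdivide: "holo f V \<Longrightarrow> holo (\<lambda>z. f z / c) V"
  unfolding divide_inverse by (intro holo_mult holo_const)

lemma coord_has_derivative:
  "((\<lambda>z. z $ k) has_derivative (\<lambda>h. \<Sum>i\<in>UNIV. (\<lambda>i. if i = k then 1 else 0) i * h $ i)) (at (z::complex^'n))"
  by (auto simp: if_distrib[of "\<lambda>x. x * _"] bounded_linear_imp_has_derivative bounded_linear_vec_nth cong: if_cong)

lemma pd_coord [simp]: "pd j (\<lambda>z. z $ k) z = (if j = k then 1 else 0)"
  by (rule pd_eq[OF coord_has_derivative])

lemma holo_coord [intro]: "holo (\<lambda>z. z $ k) V"
  by (rule holoI, rule coord_has_derivative)

lemma holo_sum [intro]: "finite A \<Longrightarrow> (\<And>i. i \<in> A \<Longrightarrow> holo (f i) V) \<Longrightarrow> holo (\<lambda>z. \<Sum>i\<in>A. f i z) V"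
  by (induction A rule: finite_induct) auto

lemma pd_sum:
  "finite A \<Longrightarrow> (\<And>i. i \<in> A \<Longrightarrow> holo (f i) V) \<Longrightarrow> z \<in> V \<Longrightarrow>
    pd j (\<lambda>z. \<Sum>i\<in>A. f i z) z = (\<Sum>i\<in>A. pd j (f i) z)"
  by (induction A rule: finite_induct) (auto simp: pd_add[where V = V] holo_sum)

lemma compose_has_derivative:
  fixes h :: "complex^'m \<Rightarrow> complex^'n"
  assumes g: "holo g V" and h: "\<And>k. holo (\<lambda>z. h z $ k) U" and z: "z \<in> U" "h z \<in> V"
  shows "((\<lambda>z. g (h z)) has_derivative (\<lambda>v. \<Sum>i\<in>UNIV. (\<Sum>k\<in>UNIV. pd k g (h z) * pd i (\<lambda>z. h z $ k) z) * v $ i)) (at z)"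
proof -
  let ?D = "\<lambda>v. \<chi> k. \<Sum>i\<in>UNIV. pd i (\<lambda>z. h z $ k) z * v $ i"
  have "(h has_derivative ?D) (at z)"
  proof (subst has_derivative_componentwise_within, rule ballI)
    fix b :: "complex^'n" assume "b \<in> Basis"
    then obtain k c where b: "b = axis k c" by (auto simp: Basis_vec_def)
    show "((\<lambda>x. h x \<bullet> b) has_derivative (\<lambda>v. ?D v \<bullet> b)) (at z)"
      unfolding b inner_axis
      using has_derivative_inner_left[OF holo_has_derivative[OF h z(1)], of k c] by simp
  qed
  from has_derivative_compose[OF this holo_has_derivative[OF g z(2)]]
  show ?thesis
    by (simp add: sum_distrib_left sum_distrib_right mult.assoc) (subst sum.swap, simp)
qed

lemmas pd_compose = pd_eq[OF compose_has_derivative]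

lemma holo_compose:
  assumes "holo g V" "\<And>k. holo (\<lambda>z. h z $ k) U" "\<And>z. z \<in> U \<Longrightarrow> h z \<in> V"
  shows "holo (\<lambda>z. g (h z)) U"
  by (rule holoI, rule compose_has_derivative[OF assms(1,2)]) (use assms(3) in auto)

section \<open>Locality and uniqueness\<close>

lemma pd_cong:
  assumes "open V" "z \<in> V" "\<And>w. w \<in> V \<Longrightarrow> f w = g w"
  shows "pd j f z = pd j g z"
proof -
  have "(f has_derivative D) (at z) \<longleftrightarrow> (g has_derivative D) (at z)" for D
    using assms has_derivative_transform_within_open[of f D z UNIV V g]
      has_derivative_transform_within_open[of g D z UNIV V f] by auto
  then show ?thesis by (simp add: pd_def frechet_derivative_def)
qed

lemma pd_zero_constant:
  assumes "holo g N" "convex N" "\<And>z i. z \<in> N \<Longrightarrow> pd i g z = 0" "z \<in> N" "w \<in> N"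
  shows "g z = g w"
proof (rule has_derivative_zero_unique[OF assms(2) _ assms(4,5)])
  fix x assume "x \<in> N"
  from holo_has_derivative[OF assms(1) this] show "(g has_derivative (\<lambda>h. 0)) (at x within N)"
    by (simp add: assms(3)[OF \<open>x \<in> N\<close>] has_derivative_at_withinI)
qed

text \<open>A point plus \<open>\<i> \<real>\<^sup>n\<close> is a set of uniqueness: it is enlarged one complex coordinate at a time.\<close>

lemma holo_zero_on_imaginary_translates:
  fixes g :: "complex^'n \<Rightarrow> complex"
  assumes g: "holo g V"
    and sub: "\<And>z. (\<And>j. norm (z $ j - c $ j) < r) \<Longrightarrow> z \<in> V"
    and zero: "\<And>z. (\<And>j. norm (z $ j - c $ j) < r) \<Longrightarrow> (\<And>j. Re (z $ j) = Re (c $ j)) \<Longrightarrow> g z = 0"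
    and z: "\<And>j. norm (z $ j - c $ j) < r"
  shows "g z = 0"
proof -
  have "\<forall>z. (\<forall>j. norm (z $ j - c $ j) < r) \<longrightarrow> (\<forall>j. j \<notin> A \<longrightarrow> Re (z $ j) = Re (c $ j)) \<longrightarrow> g z = 0"
    if "finite A" for A
    using that
  proof (induction A rule: finite_induct)
    case empty
    then show ?case using zero by auto
  next
    case (insert k A)
    show ?case
    proof (intro allI impI)
      fix z assume z: "\<forall>j. norm (z $ j - c $ j) < r" and re: "\<forall>j. j \<notin> insert k A \<longrightarrow> Re (z $ j) = Re (c $ j)"
      define z' where "z' = z - axis k (z $ k - c $ k)"
      have z': "(z' + axis k s) $ j = (if j = k then c $ k + s else z $ j)" for s j
        by (simp add: z'_def axis_def)
      have inV: "z' + axis k s \<in> V" if "norm s < r" for s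
        by (rule sub) (use z that in \<open>auto simp: z' simp del: vector_add_component\<close>)
      define \<phi> where "\<phi> s = g (z' + axis k s)" for s
      have hol: "\<phi> holomorphic_on ball 0 r"
        unfolding \<phi>_def
        by (rule holomorphic_onI, rule field_differentiable_at_within)
          (auto simp: field_differentiable_def intro!: exI holo_along_axis[OF g] inV)
      have r: "r > 0" using z norm_ge_zero order_le_less_trans by blast
      have zero': "\<phi> (\<i> * of_real t) = 0" if "\<bar>t\<bar> < r" for t
        unfolding \<phi>_def
        using insert.IH[rule_format, of "z' + axis k (\<i> * of_real t)"] z re that
        by (auto simp: z' norm_mult simp del: vector_add_component)
      have "\<phi> (z $ k - c $ k) = 0"
      \<comment> \<open>The imaginary segment, where the induction hypothesis applies, accumulates
        at the centre \<open>0\<close>.\<close>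
      proof (rule analytic_continuation[OF hol open_ball connected_ball, of "(\<lambda>t. \<i> * of_real t) ` {0<..<r}" 0])
        show "(\<lambda>t. \<i> * complex_of_real t) ` {0<..<r} \<subseteq> ball 0 r" by (auto simp: norm_mult)
        show "0 \<in> ball 0 r" "z $ k - c $ k \<in> ball 0 r" using r z by auto
        show "0 islimpt (\<lambda>t. \<i> * complex_of_real t) ` {0<..<r}"
          unfolding islimpt_approachable
        proof (intro allI impI)
          fix e :: real assume "e > 0"
          then show "\<exists>x'\<in>(\<lambda>t. \<i> * complex_of_real t) ` {0<..<r}. x' \<noteq> 0 \<and> dist x' 0 < e"
            using r by (intro bexI[of _ "\<i> * of_real (min r e / 2)"] conjI image_eqI[of _ _ "min r e / 2"])
              (auto simp: norm_mult min_def)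
        qed
        show "\<And>x. x \<in> (\<lambda>t. \<i> * complex_of_real t) ` {0<..<r} \<Longrightarrow> \<phi> x = 0" using zero' by auto
      qed
      moreover have "z' + axis k (z $ k - c $ k) = z" by (simp add: z'_def)
      ultimately show "g z = 0" by (simp add: \<phi>_def)
    qed
  qed
  from this[OF finite_class.finite_UNIV] show ?thesis using z by auto
qed

section \<open>Vector fields tangent to the tube over the cone\<close>

definition cone_tube :: "(complex^3) set" where
  "cone_tube = {Z. Re (Z $ 1) \<noteq> 0 \<and> Re (Z $ 1) * Re (Z $ 3) = (Re (Z $ 2))\<^sup>2}"

text \<open>The real derivative of \<open>Im f\<close> is \<open>Im (d * s)\<close> and vanishes;
  testing \<open>s = 1\<close> and \<open>s = \<i>\<close> removes both parts of
  \<open>d\<close>.\<close>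

lemma field_derivative_zero_if_Im_zero:
  assumes d: "(f has_field_derivative d) (at (a::complex))" and "\<forall>\<^sub>F s in nhds a. Im (f s) = 0"
  shows "d = 0"
proof -
  have "((\<lambda>s. Im (f s)) has_derivative (\<lambda>s. Im (d * s))) (at a)"
    using d unfolding has_field_derivative_def by (rule has_derivative_Im)
  moreover have "((\<lambda>s. Im (f s)) has_derivative (\<lambda>s. 0)) (at a)"
  proof -
    obtain S where "open S" "a \<in> S" "\<And>s. s \<in> S \<Longrightarrow> Im (f s) = 0"
      using assms(2) by (auto simp: eventually_nhds)
    then show ?thesis
      by (intro has_derivative_transform_within_open[OF has_derivative_const]) auto
  qed
  ultimately have "(\<lambda>s. Im (d * s)) = (\<lambda>s. 0)" by (rule has_derivative_unique)
  then have "Im (d * 1) = 0" "Im (d * \<i>) = 0" by metis+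
  then show ?thesis by (simp add: complex_eq_iff)
qed

text \<open>Degree 4 arises when a form quadratic in the null parameter is differentiated in a
  direction quadratic in it. Lower degrees are padded with zeros.\<close>

lemma quartic_zero_on_interval:
  fixes a :: "nat \<Rightarrow> complex" and p0 :: real
  assumes "e > 0" "\<And>p::real. \<bar>p - p0\<bar> < e \<Longrightarrow> a 0 + a 1 * p + a 2 * p^2 + a 3 * p^3 + a 4 * p^4 = 0"
  shows "a 0 = 0 \<and> a 1 = 0 \<and> a 2 = 0 \<and> a 3 = 0 \<and> a 4 = 0"
proof -
  let ?q = "[:a 0, a 1, a 2, a 3, a 4:]"
  have "complex_of_real ` {p0<..<p0+e} \<subseteq> {x. poly ?q x = 0}"
    using assms(2) by (auto simp: algebra_simps power2_eq_square power3_eq_cube power4_eq_xxxx)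
  moreover have "infinite (complex_of_real ` {p0<..<p0+e})"
    using assms(1) by (subst finite_image_iff) (auto simp: inj_on_def)
  ultimately have "?q = 0" using poly_roots_finite finite_subset by metis
  then show ?thesis by simp
qed

text \<open>The line through a cone point in the direction of its real part stays in \<open>cone_tube\<close>, and
  along it the null vector \<open>(p, 1)\<close> of the real part is constant.  So the function \<open>p\<^sup>2Y\<^sub>1 + 2pY\<^sub>2 + Y\<^sub>3\<close>
  is holomorphic and real along that line, hence constant.\<close>

lemma conformal_Killing_equations:
  fixes Y :: "complex^3 \<Rightarrow> complex^3"
  assumes Y: "\<And>k. holo (\<lambda>Z. Y Z $ k) V" and V: "open V" and Z0: "Z0 \<in> V" "Z0 \<in> cone_tube"
    and tan: "\<And>Z p. Z \<in> V \<Longrightarrow> Z \<in> cone_tube \<Longrightarrow> Re (Z $ 2) = - p * Re (Z $ 1) \<Longrightarrow>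
        Im (p^2 * Y Z $ 1 + 2 * p * Y Z $ 2 + Y Z $ 3) = 0"
  shows "\<exists>r>0. ball Z0 r \<subseteq> V \<and> (\<forall>Z\<in>ball Z0 r.
     pd 1 (\<lambda>Z. Y Z $ 3) Z = 0 \<and>
     2 * pd 1 (\<lambda>Z. Y Z $ 2) Z = pd 2 (\<lambda>Z. Y Z $ 3) Z \<and>
     pd 1 (\<lambda>Z. Y Z $ 1) Z - 2 * pd 2 (\<lambda>Z. Y Z $ 2) Z + pd 3 (\<lambda>Z. Y Z $ 3) Z = 0 \<and>
     2 * pd 3 (\<lambda>Z. Y Z $ 2) Z = pd 2 (\<lambda>Z. Y Z $ 1) Z \<and>
     pd 3 (\<lambda>Z. Y Z $ 1) Z = 0)"
proof -
  \<comment> \<open>The real part of \<open>Z0\<close> is \<open>t * (1, -p0, p0^2)\<close>, a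
    singular matrix with null vector \<open>(p0, 1)\<close>.\<close>
  define t where "t = Re (Z0 $ 1)"
  define p0 where "p0 = - Re (Z0 $ 2) / t"
  have t: "t \<noteq> 0" using Z0 by (simp add: cone_tube_def t_def)
  have Z02: "Re (Z0 $ 2) = - p0 * t" using t by (simp add: p0_def)
  have "t * Re (Z0 $ 3) = (p0 * t)^2" using Z0 Z02 by (simp add: cone_tube_def t_def)
  then have Z03: "Re (Z0 $ 3) = p0^2 * t" using t by (simp add: power2_eq_square field_simps)
  obtain e where e: "e > 0" "ball Z0 e \<subseteq> V" using V Z0 open_contains_ball by blast
  define R where "R = e / 3"
  have R: "R > 0" using e by (simp add: R_def)
  have sub: "Z \<in> V" if "\<And>j. norm (Z $ j - Z0 $ j) < R" for Z
  proof -
    have "norm (Z - Z0) \<le> (\<Sum>j\<in>UNIV. norm ((Z - Z0) $ j))" unfolding norm_vec_def by (rule L2_set_le_sum) auto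
    also have "\<dots> < e" using that[of 1] that[of 2] that[of 3] by (simp add: sum_3 R_def)
    finally show ?thesis using e by (auto simp: dist_norm norm_minus_commute)
  qed
  have "\<forall>\<^sub>F p in nhds p0. \<bar>(p - p0) * t\<bar> < R/4 \<and> \<bar>(p^2 - p0^2) * t\<bar> < R/4"
    by (intro eventually_conj order_tendstoD(2)[where y = 0] tendsto_rabs_zero) 
      (auto intro!: tendsto_eq_intros filterlim_ident R simp: R divide_pos_pos)
  then obtain d where d: "d > 0" and dd: "\<And>p. \<bar>p - p0\<bar> < d \<Longrightarrow> \<bar>(p - p0) * t\<bar> < R/4 \<and> \<bar>(p^2 - p0^2) * t\<bar> < R/4"
    by (auto simp: eventually_nhds_metric dist_real_def)
  define N where "N p Z = p^2 * Y Z $ 1 + 2 * p * Y Z $ 2 + Y Z $ 3" for p :: real and Z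
  \<comment> \<open>The derivative of \<open>N p\<close> in the direction
    \<open>(1, -p, p^2)\<close>, to which every singular real part with null vector
    \<open>(p, 1)\<close> is proportional.\<close>
  define G where "G p Z = pd 1 (N p) Z - p * pd 2 (N p) Z + p^2 * pd 3 (N p) Z" for p :: real and Z
  have N: "holo (N p) V" for p unfolding N_def[abs_def] by (intro holo_add holo_mult holo_const Y)
  have G: "holo (G p) V" for p
    unfolding G_def[abs_def] by (intro holo_add holo_mult holo_diff holo_const holo_pd[OF N V])
  have pdN: "pd j (N p) Z = p^2 * pd j (\<lambda>Z. Y Z $ 1) Z + 2 * p * pd j (\<lambda>Z. Y Z $ 2) Z + pd j (\<lambda>Z. Y Z $ 3) Z"
    if "Z \<in> V" for j p Z
    unfolding N_def[abs_def]
    using that by (simp add: pd_add[where V = V] pd_mult[where V = V] holo_add holo_mult holo_const Y)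
  have zero: "G p Z = 0" if "Z \<in> V" "Re (Z $ 1) = t" "Re (Z $ 2) = - p * t" "Re (Z $ 3) = p^2 * t" for p Z
  proof -
    let ?v = "vector [1, - complex_of_real p, complex_of_real p ^ 2] :: complex^3"
    have "((\<lambda>s. N p (Z + s *s ?v)) has_field_derivative (\<Sum>i\<in>UNIV. pd i (N p) (Z + 0 *s ?v) * ?v $ i)) (at 0)"
      by (rule holo_along[OF N]) (use that in simp)
    then have "((\<lambda>s. N p (Z + s *s ?v)) has_field_derivative G p Z) (at 0)"
      by (simp add: sum_3 G_def vector_3 mult.commute)
    then show ?thesis
    proof (rule field_derivative_zero_if_Im_zero)
      have c: "continuous_on UNIV (\<lambda>s. Z + s *s ?v)"
        by (intro continuous_intros linear_continuous_on bounded_linear_vector_scalar)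
      have "\<forall>\<^sub>F s in nhds 0. Z + s *s ?v \<in> V"
        using open_vimage[OF V c] that(1) by (auto simp: eventually_nhds)
      \<comment> \<open>The moved point has real part \<open>(t + Re s) * (1, -p, p^2)\<close>,
        which leaves the cone only when its first entry vanishes.\<close>
      moreover have "\<forall>\<^sub>F s in nhds 0. Re s \<noteq> - t"
      proof -
        have "((\<lambda>s. \<bar>Re s\<bar>) \<longlongrightarrow> 0) (nhds (0 :: complex))"
          by (auto intro!: tendsto_eq_intros filterlim_ident)
        from order_tendstoD(2)[OF this, of "\<bar>t\<bar>"] show ?thesis
          using t by (auto elim!: eventually_mono)
      qed
      ultimately show "\<forall>\<^sub>F s in nhds 0. Im (N p (Z + s *s ?v)) = 0"
      proof eventually_elim
        case (elim s)
        have "Z + s *s ?v \<in> cone_tube"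
          using elim that by (simp add: cone_tube_def vector_3 power2_eq_square algebra_simps)
        then show ?case
          using tan[of "Z + s *s ?v" p] elim that by (simp add: N_def vector_3 algebra_simps)
      qed
    qed
  qed
  \<comment> \<open>For a given \<open>p\<close>, \<open>zero\<close> concerns one real part only.
    The centre \<open>c\<close> has this real part and the imaginary part of \<open>Z0\<close>.
    Uniqueness gives vanishing on a polydisc about \<open>c\<close>, and this contains a polydisc
    about \<open>Z0\<close> whose radius does not depend on \<open>p\<close>. So \<open>p\<close>
    can vary while \<open>Z\<close> is kept fixed.\<close>
  have all: "G p Z = 0" if p: "\<bar>p - p0\<bar> < d" and Z: "\<And>j. norm (Z $ j - Z0 $ j) < R/4" for p Z
  proof -
    define c where "c = Z0 + vector [0, - of_real ((p - p0) * t), of_real ((p^2 - p0^2) * t)]"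
    have cR: "norm (c $ j - Z0 $ j) < R/4" for j
      using dd[OF p] exhaust_3[of j] R unfolding c_def
      by (auto simp: vector_3 simp del: of_real_mult of_real_diff)
    show ?thesis
    proof (rule holo_zero_on_imaginary_translates[OF G, where c = c and r = "R/2"])
      fix W assume W: "\<And>j. norm (W $ j - c $ j) < R/2"
      show "W \<in> V"
      proof (rule sub)
        fix j show "norm (W $ j - Z0 $ j) < R"
          using W[of j] cR[of j] R norm_triangle_lt[of "W $ j - c $ j" "c $ j - Z0 $ j" R] by simp
      qed
      assume re: "\<And>j. Re (W $ j) = Re (c $ j)"
      show "G p W = 0"
        by (rule zero[OF \<open>W \<in> V\<close>]) (simp_all add: re c_def vector_3 t_def[symmetric] Z02 Z03 algebra_simps)
    next
      fix j show "norm (Z $ j - c $ j) < R / 2"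
        using Z[of j] cR[of j] norm_triangle_lt[of "Z $ j - Z0 $ j" "Z0 $ j - c $ j" "R/2"]
        by (simp add: norm_minus_commute)
    qed
  qed
  show ?thesis
  proof (intro exI[of _ "R/4"] conjI ballI)
    show "R/4 > 0" using R by simp
    have near: "norm (Z $ j - Z0 $ j) < R/4" if "Z \<in> ball Z0 (R/4)" for Z j
      using that Finite_Cartesian_Product.norm_nth_le[of "Z - Z0" j] by (simp add: dist_norm norm_minus_commute)
    show sb: "ball Z0 (R/4) \<subseteq> V" using e R unfolding R_def by auto
    fix Z assume Z: "Z \<in> ball Z0 (R/4)"
    have ZV: "Z \<in> V" using sb Z by auto
    \<comment> \<open>The coefficients of \<open>G p Z\<close> as a polynomial in
      \<open>p\<close>.\<close>
    define a where "a n = [pd 1 (\<lambda>Z. Y Z $ 3) Z, 2 * pd 1 (\<lambda>Z. Y Z $ 2) Z - pd 2 (\<lambda>Z. Y Z $ 3) Z,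
       pd 1 (\<lambda>Z. Y Z $ 1) Z - 2 * pd 2 (\<lambda>Z. Y Z $ 2) Z + pd 3 (\<lambda>Z. Y Z $ 3) Z,
       2 * pd 3 (\<lambda>Z. Y Z $ 2) Z - pd 2 (\<lambda>Z. Y Z $ 1) Z, pd 3 (\<lambda>Z. Y Z $ 1) Z] ! n" for n
    have "a 0 + a 1 * p + a 2 * p^2 + a 3 * p^3 + a 4 * p^4 = 0" if "\<bar>p - p0\<bar> < d" for p :: real
      using all[OF that near[OF Z]] unfolding G_def pdN[OF ZV] a_def
      by (simp add: algebra_simps power2_eq_square power3_eq_cube power4_eq_xxxx numeral_nat)
    from quartic_zero_on_interval[OF d this]
    show "pd 1 (\<lambda>Z. Y Z $ 3) Z = 0" "2 * pd 1 (\<lambda>Z. Y Z $ 2) Z = pd 2 (\<lambda>Z. Y Z $ 3) Z"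
     "pd 1 (\<lambda>Z. Y Z $ 1) Z - 2 * pd 2 (\<lambda>Z. Y Z $ 2) Z + pd 3 (\<lambda>Z. Y Z $ 3) Z = 0"
     "2 * pd 3 (\<lambda>Z. Y Z $ 2) Z = pd 2 (\<lambda>Z. Y Z $ 1) Z" "pd 3 (\<lambda>Z. Y Z $ 1) Z = 0"
      by (simp_all add: a_def numeral_nat)
  qed
qed

text \<open>With \<open>(z\<^sub>1, z\<^sub>2, z\<^sub>3)\<close> standing for the symmetric matrix with rows \<open>(z\<^sub>1, z\<^sub>2)\<close> and \<open>(z\<^sub>2, z\<^sub>3)\<close>,
  the equations say \<open>D\<^sub>a Y = Y K a + a K Y\<close> for every symmetric \<open>a\<close>.\<close>

definition conformal_system :: "(complex^3 \<Rightarrow> complex^3) \<Rightarrow> (complex^3 \<Rightarrow> complex^3) \<Rightarrow> (complex^3) set \<Rightarrow> bool" where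
  "conformal_system K Y N \<longleftrightarrow> (\<forall>Z\<in>N.
     pd 1 (\<lambda>Z. Y Z $ 1) Z = 2 * (K Z $ 1 * Y Z $ 1 + K Z $ 2 * Y Z $ 2) \<and>
     pd 1 (\<lambda>Z. Y Z $ 2) Z = K Z $ 1 * Y Z $ 2 + K Z $ 2 * Y Z $ 3 \<and>
     pd 1 (\<lambda>Z. Y Z $ 3) Z = 0 \<and>
     pd 2 (\<lambda>Z. Y Z $ 1) Z = 2 * (K Z $ 2 * Y Z $ 1 + K Z $ 3 * Y Z $ 2) \<and>
     pd 2 (\<lambda>Z. Y Z $ 2) Z = K Z $ 1 * Y Z $ 1 + 2 * (K Z $ 2 * Y Z $ 2) + K Z $ 3 * Y Z $ 3 \<and>
     pd 2 (\<lambda>Z. Y Z $ 3) Z = 2 * (K Z $ 1 * Y Z $ 2 + K Z $ 2 * Y Z $ 3) \<and>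
     pd 3 (\<lambda>Z. Y Z $ 1) Z = 0 \<and>
     pd 3 (\<lambda>Z. Y Z $ 2) Z = K Z $ 2 * Y Z $ 1 + K Z $ 3 * Y Z $ 2 \<and>
     pd 3 (\<lambda>Z. Y Z $ 3) Z = 2 * (K Z $ 2 * Y Z $ 2 + K Z $ 3 * Y Z $ 3))"

text \<open>The connection coefficients \<open>\<Gamma>\<close> of the frame \<open>Y\<close> are symmetric because, up to sign, they are the second
  derivatives of \<open>h\<close> expressed in the frame; with the Killing equations only \<open>K\<close> remains free in them.\<close>

lemma conformal_system_exists:
  fixes Y :: "3 \<Rightarrow> complex^3 \<Rightarrow> complex^3" and h :: "complex^3 \<Rightarrow> complex^3"
  assumes N: "open N"
    and Y: "\<And>b k. holo (\<lambda>Z. Y b Z $ k) N" and h: "\<And>b. holo (\<lambda>Z. h Z $ b) N"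
    and inv1: "\<And>Z j k. Z \<in> N \<Longrightarrow> (\<Sum>b\<in>UNIV. Y b Z $ k * pd j (\<lambda>Z. h Z $ b) Z) = (if k = j then 1 else 0)"
    and inv2: "\<And>Z b c. Z \<in> N \<Longrightarrow> (\<Sum>i\<in>UNIV. pd i (\<lambda>Z. h Z $ b) Z * Y c Z $ i) = (if b = c then 1 else 0)"
    and CK: "\<And>Z b. Z \<in> N \<Longrightarrow> pd 1 (\<lambda>Z. Y b Z $ 3) Z = 0 \<and>
     2 * pd 1 (\<lambda>Z. Y b Z $ 2) Z = pd 2 (\<lambda>Z. Y b Z $ 3) Z \<and>
     pd 1 (\<lambda>Z. Y b Z $ 1) Z - 2 * pd 2 (\<lambda>Z. Y b Z $ 2) Z + pd 3 (\<lambda>Z. Y b Z $ 3) Z = 0 \<and>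
     2 * pd 3 (\<lambda>Z. Y b Z $ 2) Z = pd 2 (\<lambda>Z. Y b Z $ 1) Z \<and>
     pd 3 (\<lambda>Z. Y b Z $ 1) Z = 0"
  obtains K where "\<And>k. holo (\<lambda>Z. K Z $ k) N" "\<And>b. conformal_system K (Y b) N"
proof -
  \<comment> \<open>By \<open>inv1\<close> and \<open>inv2\<close> the gradients of the components
    of \<open>h\<close> form the coframe dual to the \<open>Y b\<close>. So \<open>\<Gamma>\<close>
    expresses the derivatives of the frame in terms of the frame, which is \<open>inv\<close>
    below.\<close>
  define \<Gamma> where "\<Gamma> k i j Z = (\<Sum>b\<in>UNIV. pd i (\<lambda>Z. h Z $ b) Z * pd j (\<lambda>Z. Y b Z $ k) Z)" for k i j Z
  have hol: "holo (\<Gamma> k i j) N" for k i j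
    unfolding \<Gamma>_def[abs_def] by (intro holo_sum holo_mult holo_pd[OF h N] holo_pd[OF Y N]) auto
  have \<Gamma>_hess: "\<Gamma> k i j Z = - (\<Sum>b\<in>UNIV. Y b Z $ k * pd j (pd i (\<lambda>Z. h Z $ b)) Z)" if Z: "Z \<in> N" for k i j Z
  proof -
    have "pd j (\<lambda>Z. \<Sum>b\<in>UNIV. Y b Z $ k * pd i (\<lambda>Z. h Z $ b) Z) Z = pd j (\<lambda>Z. if k = i then 1 else 0) Z"
      by (rule pd_cong[OF N Z inv1])
    then have "(\<Sum>b\<in>UNIV. pd j (\<lambda>Z. Y b Z $ k) Z * pd i (\<lambda>Z. h Z $ b) Z + Y b Z $ k * pd j (pd i (\<lambda>Z. h Z $ b)) Z) = 0"
      by (subst (asm) pd_sum[where V = N])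
        (auto simp: Z holo_mult holo_pd[OF h N] Y pd_mult[where V = N])
    then show ?thesis by (simp add: \<Gamma>_def sum.distrib add_eq_0_iff mult.commute)
  qed
  have sym: "\<Gamma> k i j Z = \<Gamma> k j i Z" if "Z \<in> N" for k i j Z
    unfolding \<Gamma>_hess[OF that] using pd_commute[OF h N that] by simp
  have "\<Gamma> 3 i 1 Z = 0 \<and> 2 * \<Gamma> 2 i 1 Z = \<Gamma> 3 i 2 Z \<and> \<Gamma> 1 i 1 Z - 2 * \<Gamma> 2 i 2 Z + \<Gamma> 3 i 3 Z = 0 \<and>
      2 * \<Gamma> 2 i 3 Z = \<Gamma> 1 i 2 Z \<and> \<Gamma> 1 i 3 Z = 0" if "Z \<in> N" for i Z
  proof -
    have "pd 1 (\<lambda>Z. Y b Z $ 3) Z = 0" "pd 2 (\<lambda>Z. Y b Z $ 3) Z = 2 * pd 1 (\<lambda>Z. Y b Z $ 2) Z"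
      "pd 1 (\<lambda>Z. Y b Z $ 1) Z = 2 * pd 2 (\<lambda>Z. Y b Z $ 2) Z - pd 3 (\<lambda>Z. Y b Z $ 3) Z"
      "pd 2 (\<lambda>Z. Y b Z $ 1) Z = 2 * pd 3 (\<lambda>Z. Y b Z $ 2) Z" "pd 3 (\<lambda>Z. Y b Z $ 1) Z = 0" for b
      using CK[OF that, of b] by (simp_all add: algebra_simps)
    note eqs = this
    show ?thesis unfolding \<Gamma>_def sum_3 eqs by (simp add: algebra_simps)
  qed
  note ck = this
  have inv: "pd j (\<lambda>Z. Y c Z $ k) Z = (\<Sum>i\<in>UNIV. Y c Z $ i * \<Gamma> k i j Z)" if Z: "Z \<in> N" for c j k Z
  proof -
    have "(\<Sum>i\<in>UNIV. Y c Z $ i * \<Gamma> k i j Z) =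
        (\<Sum>b\<in>UNIV. (\<Sum>i\<in>UNIV. pd i (\<lambda>Z. h Z $ b) Z * Y c Z $ i) * pd j (\<lambda>Z. Y b Z $ k) Z)"
      unfolding \<Gamma>_def sum_distrib_left sum_distrib_right by (subst sum.swap) (simp add: mult_ac)
    also have "\<dots> = pd j (\<lambda>Z. Y c Z $ k) Z"
      unfolding inv2[OF Z] by (simp add: if_distrib[of "\<lambda>x. x * _"] cong: if_cong)
    finally show ?thesis by simp
  qed
  \<comment> \<open>Symmetry leaves 18 coefficients and there are 15 Killing equations; these three
    remain. The halves match the factors 2 in the first and fourth equations of
    \<open>conformal_system\<close>.\<close>
  define K where "K Z = (vector [\<Gamma> 1 1 1 Z / 2, \<Gamma> 1 1 2 Z / 2, \<Gamma> 1 2 2 Z / 2] :: complex^3)" for Z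
  have "holo (\<lambda>Z. K Z $ k) N" for k
    unfolding K_def using exhaust_3[of k] by (auto simp: vector_3 intro!: holo_cdivide hol)
  moreover have "conformal_system K (Y b) N" for b
    unfolding conformal_system_def
  proof
    fix Z assume Z: "Z \<in> N"
    note e = ck[OF Z, of 1] ck[OF Z, of 2] ck[OF Z, of 3] sym[OF Z, of _ 2 1] sym[OF Z, of _ 3 1] sym[OF Z, of _ 3 2]
    have "\<Gamma> 1 1 2 Z = 2 * K Z $ 2" "\<Gamma> 2 1 1 Z = 0" "\<Gamma> 3 1 1 Z = 0"
         "\<Gamma> 1 1 1 Z = 2 * K Z $ 1" "\<Gamma> 2 1 2 Z = K Z $ 1" "\<Gamma> 3 1 2 Z = 0"
         "\<Gamma> 1 1 3 Z = 0" "\<Gamma> 2 1 3 Z = K Z $ 2" "\<Gamma> 3 1 3 Z = 0"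
         "\<Gamma> 1 2 2 Z = 2 * K Z $ 3" "\<Gamma> 2 2 2 Z = 2 * K Z $ 2" "\<Gamma> 3 2 2 Z = 2 * K Z $ 1"
         "\<Gamma> 1 2 3 Z = 0" "\<Gamma> 2 2 3 Z = K Z $ 3" "\<Gamma> 3 2 3 Z = 2 * K Z $ 2"
         "\<Gamma> 1 3 3 Z = 0" "\<Gamma> 2 3 3 Z = 0" "\<Gamma> 3 3 3 Z = 2 * K Z $ 3"
      unfolding K_def using e by (auto simp: vector_3 algebra_simps)
    note g = this sym[OF Z, of _ 2 1] sym[OF Z, of _ 3 1] sym[OF Z, of _ 3 2]
    show "pd 1 (\<lambda>Z. Y b Z $ 1) Z = 2 * (K Z $ 1 * Y b Z $ 1 + K Z $ 2 * Y b Z $ 2) \<and>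
     pd 1 (\<lambda>Z. Y b Z $ 2) Z = K Z $ 1 * Y b Z $ 2 + K Z $ 2 * Y b Z $ 3 \<and>
     pd 1 (\<lambda>Z. Y b Z $ 3) Z = 0 \<and>
     pd 2 (\<lambda>Z. Y b Z $ 1) Z = 2 * (K Z $ 2 * Y b Z $ 1 + K Z $ 3 * Y b Z $ 2) \<and>
     pd 2 (\<lambda>Z. Y b Z $ 2) Z = K Z $ 1 * Y b Z $ 1 + 2 * (K Z $ 2 * Y b Z $ 2) + K Z $ 3 * Y b Z $ 3 \<and>
     pd 2 (\<lambda>Z. Y b Z $ 3) Z = 2 * (K Z $ 1 * Y b Z $ 2 + K Z $ 2 * Y b Z $ 3) \<and>
     pd 3 (\<lambda>Z. Y b Z $ 1) Z = 0 \<and>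
     pd 3 (\<lambda>Z. Y b Z $ 2) Z = K Z $ 2 * Y b Z $ 1 + K Z $ 3 * Y b Z $ 2 \<and>
     pd 3 (\<lambda>Z. Y b Z $ 3) Z = 2 * (K Z $ 2 * Y b Z $ 2 + K Z $ 3 * Y b Z $ 3)"
      unfolding inv[OF Z] sum_3 by (simp add: g algebra_simps)
  qed
  ultimately show ?thesis using that by blast
qed

text \<open>The equations \<open>D\<^sub>a K = - K a K\<close> are the compatibility conditions \<open>D\<^sub>a D\<^sub>c Y = D\<^sub>c D\<^sub>a Y\<close>.\<close>

lemma conformal_system_Riccati:
  fixes Y :: "3 \<Rightarrow> complex^3 \<Rightarrow> complex^3"
  assumes N: "open N"
    and Y: "\<And>b k. holo (\<lambda>Z. Y b Z $ k) N" and K: "\<And>k. holo (\<lambda>Z. K Z $ k) N"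
    and inde: "\<And>Z a1 a2 a3. Z \<in> N \<Longrightarrow> (\<And>b. a1 * Y b Z $ 1 + a2 * Y b Z $ 2 + a3 * Y b Z $ 3 = 0) \<Longrightarrow>
      a1 = 0 \<and> a2 = 0 \<and> a3 = 0"
    and sys: "\<And>b. conformal_system K (Y b) N" and Z: "Z \<in> N"
  shows "pd 1 (\<lambda>Z. K Z $ 1) Z = - ((K Z $ 1)^2)" (is ?g11)
    and "pd 1 (\<lambda>Z. K Z $ 2) Z = - (K Z $ 1 * K Z $ 2)" (is ?g12)
    and "pd 1 (\<lambda>Z. K Z $ 3) Z = - ((K Z $ 2)^2)" (is ?g13)
    and "pd 2 (\<lambda>Z. K Z $ 1) Z = - (2 * K Z $ 1 * K Z $ 2)" (is ?g21)
    and "pd 2 (\<lambda>Z. K Z $ 2) Z = - (K Z $ 1 * K Z $ 3 + (K Z $ 2)^2)" (is ?g22)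
    and "pd 2 (\<lambda>Z. K Z $ 3) Z = - (2 * K Z $ 2 * K Z $ 3)" (is ?g23)
    and "pd 3 (\<lambda>Z. K Z $ 1) Z = - ((K Z $ 2)^2)" (is ?g31)
    and "pd 3 (\<lambda>Z. K Z $ 2) Z = - (K Z $ 2 * K Z $ 3)" (is ?g32)
    and "pd 3 (\<lambda>Z. K Z $ 3) Z = - ((K Z $ 3)^2)" (is ?g33)
proof -
  note rules = pd_add[where V = N] pd_mult[where V = N] holo_add holo_mult holo_const Y K Z pd_const
  have s: "pd 1 (\<lambda>Z. Y b Z $ 1) W = 2 * (K W $ 1 * Y b W $ 1 + K W $ 2 * Y b W $ 2)"
     "pd 1 (\<lambda>Z. Y b Z $ 2) W = K W $ 1 * Y b W $ 2 + K W $ 2 * Y b W $ 3"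
     "pd 1 (\<lambda>Z. Y b Z $ 3) W = 0"
     "pd 2 (\<lambda>Z. Y b Z $ 1) W = 2 * (K W $ 2 * Y b W $ 1 + K W $ 3 * Y b W $ 2)"
     "pd 2 (\<lambda>Z. Y b Z $ 2) W = K W $ 1 * Y b W $ 1 + 2 * (K W $ 2 * Y b W $ 2) + K W $ 3 * Y b W $ 3"
     "pd 2 (\<lambda>Z. Y b Z $ 3) W = 2 * (K W $ 1 * Y b W $ 2 + K W $ 2 * Y b W $ 3)"
     "pd 3 (\<lambda>Z. Y b Z $ 1) W = 0"
     "pd 3 (\<lambda>Z. Y b Z $ 2) W = K W $ 2 * Y b W $ 1 + K W $ 3 * Y b W $ 2"
     "pd 3 (\<lambda>Z. Y b Z $ 3) W = 2 * (K W $ 2 * Y b W $ 2 + K W $ 3 * Y b W $ 3)"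
    if "W \<in> N" for b W
    using sys[of b] that unfolding conformal_system_def by blast+
  note sc = s[THEN pd_cong[OF N Z]]
  \<comment> \<open>Since \<open>pd 1\<close> of the third component vanishes identically, commuting
    \<open>pd 1\<close> and \<open>pd 3\<close> there involves derivatives of \<open>K\<close> in
    direction 1 only. The relation holds for all \<open>b\<close>, so independence of the frame
    splits it into its coefficients.\<close>
  have "0 * Y b Z $ 1 + (pd 1 (\<lambda>Z. K Z $ 2) Z + K Z $ 1 * K Z $ 2) * Y b Z $ 2
      + (pd 1 (\<lambda>Z. K Z $ 3) Z + (K Z $ 2)^2) * Y b Z $ 3 = 0" for b
    using pd_commute[OF Y N Z, of 1 3 b 3]
    by (simp only: sc rules s[OF Z]) algebra
  from inde[OF Z this] have k1: "pd 1 (\<lambda>Z. K Z $ 2) Z + K Z $ 1 * K Z $ 2 = 0" "pd 1 (\<lambda>Z. K Z $ 3) Z + (K Z $ 2)^2 = 0" by auto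
  then show ?g12 ?g13 by (auto simp: add_eq_0_iff)
  note k12 = this
  have "0 * Y b Z $ 1 + (pd 1 (\<lambda>Z. K Z $ 1) Z + (K Z $ 1)^2) * Y b Z $ 2
      + (pd 1 (\<lambda>Z. K Z $ 2) Z + K Z $ 1 * K Z $ 2) * Y b Z $ 3 = 0" for b
    using pd_commute[OF Y N Z, of 1 2 b 3]
    by (simp only: sc rules s[OF Z]) algebra
  from inde[OF Z this] show k11: ?g11 by (auto simp: add_eq_0_iff2)
  have "(pd 3 (\<lambda>Z. K Z $ 1) Z + (K Z $ 2)^2) * Y b Z $ 1
      + (pd 3 (\<lambda>Z. K Z $ 2) Z + K Z $ 2 * K Z $ 3) * Y b Z $ 2 + 0 * Y b Z $ 3 = 0" for b
    using pd_commute[OF Y N Z, of 3 1 b 1]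
    by (simp only: sc rules s[OF Z]) algebra
  from inde[OF Z this] have k3: "pd 3 (\<lambda>Z. K Z $ 1) Z + (K Z $ 2)^2 = 0" "pd 3 (\<lambda>Z. K Z $ 2) Z + K Z $ 2 * K Z $ 3 = 0" by auto
  then show ?g31 ?g32 by (auto simp: add_eq_0_iff)
  note k31 = this
  have "(pd 3 (\<lambda>Z. K Z $ 2) Z + K Z $ 2 * K Z $ 3) * Y b Z $ 1
      + (pd 3 (\<lambda>Z. K Z $ 3) Z + (K Z $ 3)^2) * Y b Z $ 2 + 0 * Y b Z $ 3 = 0" for b
    using pd_commute[OF Y N Z, of 3 2 b 1]
    by (simp only: sc rules s[OF Z]) algebra
  from inde[OF Z this] show k33: ?g33 by (auto simp: add_eq_0_iff2)
  \<comment> \<open>Derivatives of \<open>K\<close> in two directions meet here; those in direction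
    1 are known from \<open>k12\<close>.\<close>
  have "(pd 2 (\<lambda>Z. K Z $ 1) Z + 2 * K Z $ 1 * K Z $ 2) * Y b Z $ 1
      + (pd 2 (\<lambda>Z. K Z $ 2) Z + (K Z $ 1 * K Z $ 3 + (K Z $ 2)^2)) * Y b Z $ 2 + 0 * Y b Z $ 3 = 0" for b
    using pd_commute[OF Y N Z, of 2 1 b 1]
    by (simp only: sc rules s[OF Z] k12) algebra
  from inde[OF Z this] show ?g21 ?g22 by (auto simp: add_eq_0_iff2)
  have "0 * Y b Z $ 1 + (pd 2 (\<lambda>Z. K Z $ 2) Z + (K Z $ 1 * K Z $ 3 + (K Z $ 2)^2)) * Y b Z $ 2
      + (pd 2 (\<lambda>Z. K Z $ 3) Z + 2 * K Z $ 2 * K Z $ 3) * Y b Z $ 3 = 0" for b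
    using pd_commute[OF Y N Z, of 2 3 b 3]
    by (simp only: sc rules s[OF Z] k31) algebra
  from inde[OF Z this] show ?g23 by (auto simp: add_eq_0_iff2)
qed

section \<open>Solution of the conformal system\<close>

text \<open>The symmetric matrix \<open>(1 + W K) Y (1 + K W)\<close>.\<close>

definition mobius_field :: "complex^3 \<Rightarrow> complex^3 \<Rightarrow> complex^3 \<Rightarrow> complex^3" where
  "mobius_field K Y W =
    (let a = 1 + K $ 1 * W $ 1 + K $ 2 * W $ 2; b = K $ 1 * W $ 2 + K $ 2 * W $ 3;
         c = K $ 2 * W $ 1 + K $ 3 * W $ 2; d = 1 + K $ 2 * W $ 2 + K $ 3 * W $ 3
     in vector [a * a * Y $ 1 + 2 * a * c * Y $ 2 + c * c * Y $ 3,
        a * b * Y $ 1 + (a * d + b * c) * Y $ 2 + c * d * Y $ 3,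
        b * b * Y $ 1 + 2 * b * d * Y $ 2 + d * d * Y $ 3])"

text \<open>The matrix \<open>K Y K\<close> is constant, so all second derivatives of \<open>Y\<close> are constant.\<close>

lemma conformal_system_solution:
  fixes Y K :: "complex^3 \<Rightarrow> complex^3"
  assumes N: "convex N" and Z0: "Z0 \<in> N"
    and Y: "\<And>k. holo (\<lambda>Z. Y Z $ k) N" and K: "\<And>k. holo (\<lambda>Z. K Z $ k) N"
    and sys: "conformal_system K Y N"
    and riccati: "\<And>Z. Z \<in> N \<Longrightarrow> pd 1 (\<lambda>Z. K Z $ 1) Z = - ((K Z $ 1)^2)"
     "\<And>Z. Z \<in> N \<Longrightarrow> pd 1 (\<lambda>Z. K Z $ 2) Z = - (K Z $ 1 * K Z $ 2)"
     "\<And>Z. Z \<in> N \<Longrightarrow> pd 1 (\<lambda>Z. K Z $ 3) Z = - ((K Z $ 2)^2)"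
     "\<And>Z. Z \<in> N \<Longrightarrow> pd 2 (\<lambda>Z. K Z $ 1) Z = - (2 * K Z $ 1 * K Z $ 2)"
     "\<And>Z. Z \<in> N \<Longrightarrow> pd 2 (\<lambda>Z. K Z $ 2) Z = - (K Z $ 1 * K Z $ 3 + (K Z $ 2)^2)"
     "\<And>Z. Z \<in> N \<Longrightarrow> pd 2 (\<lambda>Z. K Z $ 3) Z = - (2 * K Z $ 2 * K Z $ 3)"
     "\<And>Z. Z \<in> N \<Longrightarrow> pd 3 (\<lambda>Z. K Z $ 1) Z = - ((K Z $ 2)^2)"
     "\<And>Z. Z \<in> N \<Longrightarrow> pd 3 (\<lambda>Z. K Z $ 2) Z = - (K Z $ 2 * K Z $ 3)"
     "\<And>Z. Z \<in> N \<Longrightarrow> pd 3 (\<lambda>Z. K Z $ 3) Z = - ((K Z $ 3)^2)"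
    and Z: "Z \<in> N"
  shows "Y Z = mobius_field (K Z0) (Y Z0) (Z - Z0)"
proof -
  note hol = holo_add holo_diff holo_mult holo_const holo_coord Y K
  note rules = pd_add[where V = N] pd_diff[where V = N] pd_mult[where V = N] hol pd_const pd_coord
  have s: "pd 1 (\<lambda>Z. Y Z $ 1) W = 2 * (K W $ 1 * Y W $ 1 + K W $ 2 * Y W $ 2)"
     "pd 1 (\<lambda>Z. Y Z $ 2) W = K W $ 1 * Y W $ 2 + K W $ 2 * Y W $ 3"
     "pd 1 (\<lambda>Z. Y Z $ 3) W = 0"
     "pd 2 (\<lambda>Z. Y Z $ 1) W = 2 * (K W $ 2 * Y W $ 1 + K W $ 3 * Y W $ 2)"
     "pd 2 (\<lambda>Z. Y Z $ 2) W = K W $ 1 * Y W $ 1 + 2 * (K W $ 2 * Y W $ 2) + K W $ 3 * Y W $ 3"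
     "pd 2 (\<lambda>Z. Y Z $ 3) W = 2 * (K W $ 1 * Y W $ 2 + K W $ 2 * Y W $ 3)"
     "pd 3 (\<lambda>Z. Y Z $ 1) W = 0"
     "pd 3 (\<lambda>Z. Y Z $ 2) W = K W $ 2 * Y W $ 1 + K W $ 3 * Y W $ 2"
     "pd 3 (\<lambda>Z. Y Z $ 3) W = 2 * (K W $ 2 * Y W $ 2 + K W $ 3 * Y W $ 3)"
    if "W \<in> N" for W
    using sys that unfolding conformal_system_def by blast+
  have const: "g W = g Z0" if "holo g N" "\<And>X. X \<in> N \<Longrightarrow> pd 1 g X = 0" "\<And>X. X \<in> N \<Longrightarrow> pd 2 g X = 0"
      "\<And>X. X \<in> N \<Longrightarrow> pd 3 g X = 0" "W \<in> N" for g W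
    by (rule pd_zero_constant[OF that(1) N _ that(5) Z0]) (metis that(2-4) exhaust_3)
  have eq: "g W = f W" if "holo g N" "holo f N" "W \<in> N"
      "\<And>X. X \<in> N \<Longrightarrow> pd 1 g X = pd 1 f X" "\<And>X. X \<in> N \<Longrightarrow> pd 2 g X = pd 2 f X"
      "\<And>X. X \<in> N \<Longrightarrow> pd 3 g X = pd 3 f X" "g Z0 = f Z0" for f g W
    using const[of "\<lambda>Z. g Z - f Z" W] that by (simp add: holo_diff pd_diff[where V = N])
  \<comment> \<open>The entries of \<open>K Y K\<close>. Under \<open>D_a Y = Y K a + a K Y\<close>
    and \<open>D_a K = - K a K\<close> the four terms of its derivative cancel in pairs.\<close>
  define c1 where "c1 X = K X $ 1 * K X $ 1 * Y X $ 1 + 2 * (K X $ 1 * K X $ 2 * Y X $ 2) + K X $ 2 * K X $ 2 * Y X $ 3" for X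
  define c2 where "c2 X = K X $ 1 * K X $ 2 * Y X $ 1 + (K X $ 1 * K X $ 3 + K X $ 2 * K X $ 2) * Y X $ 2 + K X $ 2 * K X $ 3 * Y X $ 3" for X
  define c3 where "c3 X = K X $ 2 * K X $ 2 * Y X $ 1 + 2 * (K X $ 2 * K X $ 3 * Y X $ 2) + K X $ 3 * K X $ 3 * Y X $ 3" for X
  have c: "c1 X = c1 Z0" "c2 X = c2 Z0" "c3 X = c3 Z0" if "X \<in> N" for X
    by (rule const[OF _ _ _ _ that]; unfold c1_def c2_def c3_def;
        simp only: rules s riccati; algebra?)+
  define y1 where "y1 = Y Z0 $ 1"
  define y2 where "y2 = Y Z0 $ 2"
  define y3 where "y3 = Y Z0 $ 3"
  define k1 where "k1 = K Z0 $ 1"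
  define k2 where "k2 = K Z0 $ 2"
  define k3 where "k3 = K Z0 $ 3"
  define C1 where "C1 = c1 Z0"
  define C2 where "C2 = c2 Z0"
  define C3 where "C3 = c3 Z0"
  note cc = c[unfolded C1_def[symmetric] C2_def[symmetric] C3_def[symmetric], unfolded c1_def c2_def c3_def]
  define w1 where "w1 X = X $ 1 - Z0 $ 1" for X :: "complex^3"
  define w2 where "w2 X = X $ 2 - Z0 $ 2" for X :: "complex^3"
  define w3 where "w3 X = X $ 3 - Z0 $ 3" for X :: "complex^3"
  have w: "holo w1 N" "holo w2 N" "holo w3 N"
    unfolding w1_def[abs_def] w2_def[abs_def] w3_def[abs_def] by (intro hol)+
  have pw: "pd i w1 X = (if i = 1 then 1 else 0)" "pd i w2 X = (if i = 2 then 1 else 0)"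
    "pd i w3 X = (if i = 3 then 1 else 0)" if "X \<in> N" for i X
    unfolding w1_def[abs_def] w2_def[abs_def] w3_def[abs_def] using that by (simp_all add: rules)
  note rules = rules w pw
  have ne: "(1::3) \<noteq> 2" "(1::3) \<noteq> 3" "(2::3) \<noteq> 3" "(2::3) \<noteq> 1" "(3::3) \<noteq> 1" "(3::3) \<noteq> 2" by auto
  have w0: "w1 Z0 = 0" "w2 Z0 = 0" "w3 Z0 = 0" by (simp_all add: w1_def w2_def w3_def)
  \<comment> \<open>In matrix form \<open>D_a (K Y) = (K Y K) a\<close>, so the right-hand sides of
    the system have constant gradients and are affine.\<close>
  have d2:
    "pd 1 (\<lambda>X. 2 * (K X $ 1 * Y X $ 1 + K X $ 2 * Y X $ 2)) X = 2 * C1"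
    "pd 2 (\<lambda>X. 2 * (K X $ 1 * Y X $ 1 + K X $ 2 * Y X $ 2)) X = 2 * C2"
    "pd 3 (\<lambda>X. 2 * (K X $ 1 * Y X $ 1 + K X $ 2 * Y X $ 2)) X = 0"
    "pd 1 (\<lambda>X. K X $ 1 * Y X $ 2 + K X $ 2 * Y X $ 3) X = 0"
    "pd 2 (\<lambda>X. K X $ 1 * Y X $ 2 + K X $ 2 * Y X $ 3) X = C1"
    "pd 3 (\<lambda>X. K X $ 1 * Y X $ 2 + K X $ 2 * Y X $ 3) X = C2"
    "pd 1 (\<lambda>X. 2 * (K X $ 2 * Y X $ 1 + K X $ 3 * Y X $ 2)) X = 2 * C2"
    "pd 2 (\<lambda>X. 2 * (K X $ 2 * Y X $ 1 + K X $ 3 * Y X $ 2)) X = 2 * C3"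
    "pd 3 (\<lambda>X. 2 * (K X $ 2 * Y X $ 1 + K X $ 3 * Y X $ 2)) X = 0"
    "pd 1 (\<lambda>X. K X $ 1 * Y X $ 1 + 2 * (K X $ 2 * Y X $ 2) + K X $ 3 * Y X $ 3) X = C1"
    "pd 2 (\<lambda>X. K X $ 1 * Y X $ 1 + 2 * (K X $ 2 * Y X $ 2) + K X $ 3 * Y X $ 3) X = 2 * C2"
    "pd 3 (\<lambda>X. K X $ 1 * Y X $ 1 + 2 * (K X $ 2 * Y X $ 2) + K X $ 3 * Y X $ 3) X = C3"
    "pd 1 (\<lambda>X. 2 * (K X $ 1 * Y X $ 2 + K X $ 2 * Y X $ 3)) X = 0"
    "pd 2 (\<lambda>X. 2 * (K X $ 1 * Y X $ 2 + K X $ 2 * Y X $ 3)) X = 2 * C1"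
    "pd 3 (\<lambda>X. 2 * (K X $ 1 * Y X $ 2 + K X $ 2 * Y X $ 3)) X = 2 * C2"
    "pd 1 (\<lambda>X. K X $ 2 * Y X $ 1 + K X $ 3 * Y X $ 2) X = C2"
    "pd 2 (\<lambda>X. K X $ 2 * Y X $ 1 + K X $ 3 * Y X $ 2) X = C3"
    "pd 3 (\<lambda>X. K X $ 2 * Y X $ 1 + K X $ 3 * Y X $ 2) X = 0"
    "pd 1 (\<lambda>X. 2 * (K X $ 2 * Y X $ 2 + K X $ 3 * Y X $ 3)) X = 0"
    "pd 2 (\<lambda>X. 2 * (K X $ 2 * Y X $ 2 + K X $ 3 * Y X $ 3)) X = 2 * C2"
    "pd 3 (\<lambda>X. 2 * (K X $ 2 * Y X $ 2 + K X $ 3 * Y X $ 3)) X = 2 * C3"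
    if X: "X \<in> N" for X
    by (simp only: rules s[OF X] riccati[OF X] X cc[OF X, symmetric]; algebra)+
  have aff: "g W = g Z0 + a1 * w1 W + a2 * w2 W + a3 * w3 W" if "holo g N" "W \<in> N"
      "\<And>X. X \<in> N \<Longrightarrow> pd 1 g X = a1" "\<And>X. X \<in> N \<Longrightarrow> pd 2 g X = a2" "\<And>X. X \<in> N \<Longrightarrow> pd 3 g X = a3" for g W a1 a2 a3
    by (rule eq[OF that(1) _ that(2)]; simp only: that(3-5) rules ne simp_thms if_True if_False w0; simp)
  have d1:
    "2 * (K X $ 1 * Y X $ 1 + K X $ 2 * Y X $ 2) = 2 * (k1 * y1 + k2 * y2) + 2 * C1 * w1 X + 2 * C2 * w2 X"
    "K X $ 1 * Y X $ 2 + K X $ 2 * Y X $ 3 = k1 * y2 + k2 * y3 + C1 * w2 X + C2 * w3 X"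
    "2 * (K X $ 2 * Y X $ 1 + K X $ 3 * Y X $ 2) = 2 * (k2 * y1 + k3 * y2) + 2 * C2 * w1 X + 2 * C3 * w2 X"
    "K X $ 1 * Y X $ 1 + 2 * (K X $ 2 * Y X $ 2) + K X $ 3 * Y X $ 3 = k1 * y1 + 2 * (k2 * y2) + k3 * y3 + C1 * w1 X + 2 * C2 * w2 X + C3 * w3 X"
    "2 * (K X $ 1 * Y X $ 2 + K X $ 2 * Y X $ 3) = 2 * (k1 * y2 + k2 * y3) + 2 * C1 * w2 X + 2 * C2 * w3 X"
    "K X $ 2 * Y X $ 1 + K X $ 3 * Y X $ 2 = k2 * y1 + k3 * y2 + C2 * w1 X + C3 * w2 X"
    "2 * (K X $ 2 * Y X $ 2 + K X $ 3 * Y X $ 3) = 2 * (k2 * y2 + k3 * y3) + 2 * C2 * w2 X + 2 * C3 * w3 X"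
    if X: "X \<in> N" for X
    unfolding k1_def k2_def k3_def y1_def y2_def y3_def
    subgoal by (rule trans[OF aff[OF _ X d2(1-3)]]; (simp only: hol)?; simp)
    subgoal by (rule trans[OF aff[OF _ X d2(4-6)]]; (simp only: hol)?; simp)
    subgoal by (rule trans[OF aff[OF _ X d2(7-9)]]; (simp only: hol)?; simp)
    subgoal by (rule trans[OF aff[OF _ X d2(10-12)]]; (simp only: hol)?; simp)
    subgoal by (rule trans[OF aff[OF _ X d2(13-15)]]; (simp only: hol)?; simp)
    subgoal by (rule trans[OF aff[OF _ X d2(16-18)]]; (simp only: hol)?; simp)
    subgoal by (rule trans[OF aff[OF _ X d2(19-21)]]; (simp only: hol)?; simp)
    done
  \<comment> \<open>Entries of \<open>Y0 + W K0 Y0 + Y0 K0 W + W C W\<close> with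
    \<open>C = K0 Y0 K0\<close>. Both sides have the same first derivatives and the same value at
    \<open>Z0\<close>.\<close>
  have "Y Z $ 1 = y1 + 2 * (k1 * y1 + k2 * y2) * w1 Z + 2 * (k2 * y1 + k3 * y2) * w2 Z
      + C1 * w1 Z * w1 Z + 2 * C2 * w1 Z * w2 Z + C3 * w2 Z * w2 Z"
    by (rule eq[OF _ _ Z]; simp only: rules s d1 ne simp_thms if_True if_False w0 y1_def; algebra?)
  moreover have "Y Z $ 2 = y2 + (k1 * y2 + k2 * y3) * w1 Z + (k1 * y1 + 2 * (k2 * y2) + k3 * y3) * w2 Z + (k2 * y1 + k3 * y2) * w3 Z
      + C1 * w1 Z * w2 Z + C2 * (w1 Z * w3 Z + w2 Z * w2 Z) + C3 * w2 Z * w3 Z"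
    by (rule eq[OF _ _ Z]; simp only: rules s d1 ne simp_thms if_True if_False w0 y2_def; algebra?)
  moreover have "Y Z $ 3 = y3 + 2 * (k1 * y2 + k2 * y3) * w2 Z + 2 * (k2 * y2 + k3 * y3) * w3 Z
      + C1 * w2 Z * w2 Z + 2 * C2 * w2 Z * w3 Z + C3 * w3 Z * w3 Z"
    by (rule eq[OF _ _ Z]; simp only: rules s d1 ne simp_thms if_True if_False w0 y3_def; algebra?)
  moreover have "C1 = k1 * k1 * y1 + 2 * (k1 * k2 * y2) + k2 * k2 * y3"
    "C2 = k1 * k2 * y1 + (k1 * k3 + k2 * k2) * y2 + k2 * k3 * y3"
    "C3 = k2 * k2 * y1 + 2 * (k2 * k3 * y2) + k3 * k3 * y3"
    by (simp_all add: C1_def C2_def C3_def c1_def c2_def c3_def k1_def k2_def k3_def y1_def y2_def y3_def)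
  ultimately show ?thesis
    unfolding vec_eq_iff forall_3 mobius_field_def Let_def vector_3 vector_minus_component
      w1_def[symmetric] w2_def[symmetric] w3_def[symmetric] k1_def[symmetric] k2_def[symmetric] k3_def[symmetric]
      y1_def[symmetric] y2_def[symmetric] y3_def[symmetric]
    by (intro conjI; algebra)
qed

section \<open>Reality and change of base point\<close>

text \<open>Polymorphic, since it is applied to complex points and to their real parts.\<close>

definition sdet :: "'a::comm_ring_1^3 \<Rightarrow> 'a" where
  "sdet Z = Z $ 1 * Z $ 3 - (Z $ 2)^2"

text \<open>The determinant of \<open>1 + K W\<close>.\<close>

definition mdet :: "complex^3 \<Rightarrow> complex^3 \<Rightarrow> complex" where
  "mdet K W = 1 + K $ 1 * W $ 1 + 2 * K $ 2 * W $ 2 + K $ 3 * W $ 3 + sdet K * sdet W"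

lemma mdet_eq:
  "mdet K W = (1 + K $ 1 * W $ 1 + K $ 2 * W $ 2) * (1 + K $ 2 * W $ 2 + K $ 3 * W $ 3)
     - (K $ 1 * W $ 2 + K $ 2 * W $ 3) * (K $ 2 * W $ 1 + K $ 3 * W $ 2)"
  unfolding mdet_def sdet_def by algebra

text \<open>The quadratic form at the null vector \<open>(p, 1)\<close> of the real part depends on \<open>Z\<close> only through
  \<open>Z (p, 1)\<close>, so at a cone point its value equals that at the imaginary part of the point.\<close>

lemma mobius_field_real_on_imaginary:
  assumes r: "r > 0" and Z0: "Z0 \<in> cone_tube"
    and real: "\<And>Z p. Z \<in> ball Z0 r \<Longrightarrow> Z \<in> cone_tube \<Longrightarrow> Re (Z $ 2) = - p * Re (Z $ 1) \<Longrightarrow>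
      Im (of_real p ^ 2 * mobius_field K y (Z - Z0) $ 1 + 2 * of_real p * mobius_field K y (Z - Z0) $ 2
        + mobius_field K y (Z - Z0) $ 3) = 0"
    and X: "\<And>j. Re (X $ j) = 0"
  shows "Im (mobius_field K y (X - Z0) $ k) = 0"
proof -
  define t where "t = Re (Z0 $ 1)"
  define p0 where "p0 = - Re (Z0 $ 2) / t"
  have t: "t \<noteq> 0" using Z0 by (simp add: cone_tube_def t_def)
  have Z02: "Re (Z0 $ 2) = - p0 * t" using t by (simp add: p0_def)
  have "t * Re (Z0 $ 3) = (p0 * t)^2" using Z0 Z02 by (simp add: cone_tube_def t_def)
  then have Z03: "Re (Z0 $ 3) = p0^2 * t" using t by (simp add: power2_eq_square field_simps)
  have "\<forall>\<^sub>F p in nhds p0. \<bar>(p - p0) * t\<bar> < r/8 \<and> \<bar>(p^2 - p0^2) * t\<bar> < r/8"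
    by (intro eventually_conj order_tendstoD(2)[where y = 0] tendsto_rabs_zero)
      (auto intro!: tendsto_eq_intros filterlim_ident r simp: r divide_pos_pos)
  then obtain d where d: "d > 0" and dd: "\<And>p. \<bar>p - p0\<bar> < d \<Longrightarrow> \<bar>(p - p0) * t\<bar> < r/8 \<and> \<bar>(p^2 - p0^2) * t\<bar> < r/8"
    by (auto simp: eventually_nhds_metric dist_real_def)
  define q where "q p Z = of_real p ^ 2 * mobius_field K y (Z - Z0) $ 1 + 2 * of_real p * mobius_field K y (Z - Z0) $ 2
        + mobius_field K y (Z - Z0) $ 3" for p :: real and Z
  \<comment> \<open>The quadratic form of the matrix \<open>y\<close>; \<open>q p Z\<close> is its
    value at the vector \<open>(1 + K W) (p, 1)\<close> with \<open>W = Z - Z0\<close>.\<close>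
  define Q where "Q u v \<equiv> u * u * y $ 1 + 2 * u * v * y $ 2 + v * v * y $ 3" for u v
  have q: "q p Z = Q (p + K $ 1 * ((Z $ 1 - Z0 $ 1) * p + (Z $ 2 - Z0 $ 2)) + K $ 2 * ((Z $ 2 - Z0 $ 2) * p + (Z $ 3 - Z0 $ 3)))
     (1 + K $ 2 * ((Z $ 1 - Z0 $ 1) * p + (Z $ 2 - Z0 $ 2)) + K $ 3 * ((Z $ 2 - Z0 $ 2) * p + (Z $ 3 - Z0 $ 3)))" for p Z
    unfolding q_def Q_def mobius_field_def Let_def vector_3 vector_minus_component by algebra
  have zero: "Im (q p X) = 0" if p: "\<bar>p - p0\<bar> < d" for p
  proof -
    define c where "c = Z0 + vector [0, - of_real ((p - p0) * t), of_real ((p^2 - p0^2) * t)]"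
    \<comment> \<open>Purely imaginary, so \<open>c + s B\<close> keeps the real part of
      \<open>c\<close> for real \<open>s\<close>, and at \<open>s = 1\<close> it has the imaginary
      part of \<open>X\<close>.\<close>
    define B where "B = (\<chi> j. X $ j - \<i> * of_real (Im (Z0 $ j)))"
    have cr: "norm (c - Z0) < r/2"
    proof -
      have "norm (c - Z0) \<le> (\<Sum>j\<in>UNIV. norm ((c - Z0) $ j))" unfolding norm_vec_def by (rule L2_set_le_sum) auto
      also have "\<dots> < r/2"
        using dd[OF p] r unfolding c_def by (simp add: sum_3 vector_3 del: of_real_mult of_real_diff)
      finally show ?thesis .
    qed
    have B: "Re (B $ j) = 0" for j using X by (simp add: B_def)
    have small: "Im (q p (c + of_real s *s B)) = 0" if s: "\<bar>s\<bar> * norm B < r/2" for s :: real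
      unfolding q_def
    proof (rule real)
      have "norm (of_real s *s B) = \<bar>s\<bar> * norm B"
      proof -
        have "of_real s *s B = s *\<^sub>R B" by (simp only: vec_eq_iff vector_smult_component vector_scaleR_component) (simp add: scaleR_conv_of_real)
        then show ?thesis by simp
      qed
      then show "c + of_real s *s B \<in> ball Z0 r"
        using cr s norm_triangle_ineq[of "c - Z0" "of_real s *s B"]
        by (simp add: dist_norm norm_minus_commute[of Z0] algebra_simps)
      show "Re ((c + of_real s *s B) $ 2) = - p * Re ((c + of_real s *s B) $ 1)"
        "c + of_real s *s B \<in> cone_tube"
        using t by (simp_all add: cone_tube_def c_def vector_3 B t_def[symmetric] Z02 Z03 power2_eq_square algebra_simps)
    qed
    define A1 where "A1 = p + K $ 1 * ((c $ 1 - Z0 $ 1) * p + (c $ 2 - Z0 $ 2)) + K $ 2 * ((c $ 2 - Z0 $ 2) * p + (c $ 3 - Z0 $ 3))"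
    define D1 where "D1 = K $ 1 * (B $ 1 * p + B $ 2) + K $ 2 * (B $ 2 * p + B $ 3)"
    define A2 where "A2 = 1 + K $ 2 * ((c $ 1 - Z0 $ 1) * p + (c $ 2 - Z0 $ 2)) + K $ 3 * ((c $ 2 - Z0 $ 2) * p + (c $ 3 - Z0 $ 3))"
    define D2 where "D2 = K $ 2 * (B $ 1 * p + B $ 2) + K $ 3 * (B $ 2 * p + B $ 3)"
    define M where "M = 2 * A1 * D1 * y $ 1 + 2 * (A1 * D2 + D1 * A2) * y $ 2 + 2 * A2 * D2 * y $ 3"
    \<comment> \<open>The point with \<open>s = 1\<close> may lie outside the ball where reality is
      known. But \<open>q p\<close> is quadratic in \<open>s\<close> along this line, and real
      values for small \<open>s\<close> force real coefficients.\<close>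
    have qs: "q p (c + s *s B) = Q A1 A2 + s * M
        + s^2 * Q D1 D2" for s
      unfolding q M_def A1_def A2_def D1_def D2_def Q_def vector_add_component vector_smult_component by algebra
    define a where "a n = complex_of_real ([Im (Q A1 A2), Im M,
       Im (Q D1 D2), 0, 0] ! n)" for n
    have e: "r / (2 * (norm B + 1)) > 0" using r by (simp add: add_nonneg_pos)
    have "a 0 + a 1 * s + a 2 * s^2 + a 3 * s^3 + a 4 * s^4 = 0" if "\<bar>s - 0\<bar> < r / (2 * (norm B + 1))" for s :: real
    proof -
      have "0 < 2 * (norm B + 1)" by (simp add: add_nonneg_pos)
      from pos_less_divide_eq[OF this, of "\<bar>s\<bar>" r] have "\<bar>s\<bar> * (norm B + 1) < r / 2" using that by (simp add: algebra_simps)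
      then have "\<bar>s\<bar> * norm B < r / 2" using abs_ge_zero[of s] by (simp add: algebra_simps)
      from small[OF this] show ?thesis unfolding qs a_def
        by (simp add: numeral_nat complex_eq_iff power2_eq_square mult_ac)
    qed
    from quartic_zero_on_interval[OF e, of 0 a, OF this]
    have "Im (Q A1 A2) = 0" "Im M = 0" "Im (Q D1 D2) = 0"
      by (simp_all add: a_def numeral_nat)
    then have "Im (q p (c + 1 *s B)) = 0" unfolding qs by simp
    moreover have "q p (c + 1 *s B) = q p X"
    proof -
      have cc: "c $ 1 = t + \<i> * Im (Z0 $ 1)" "c $ 2 = - p * t + \<i> * Im (Z0 $ 2)" "c $ 3 = p^2 * t + \<i> * Im (Z0 $ 3)"
        by (simp_all add: c_def vector_3 complex_eq_iff t_def[symmetric] Z02 Z03 algebra_simps)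
      have "((c $ 1 + B $ 1 - Z0 $ 1) * p + (c $ 2 + B $ 2 - Z0 $ 2)) = ((X $ 1 - Z0 $ 1) * p + (X $ 2 - Z0 $ 2))"
        "((c $ 2 + B $ 2 - Z0 $ 2) * p + (c $ 3 + B $ 3 - Z0 $ 3)) = ((X $ 2 - Z0 $ 2) * p + (X $ 3 - Z0 $ 3))"
        unfolding cc by (simp_all add: B_def algebra_simps power2_eq_square)
      note eqs = this
      show ?thesis unfolding q vector_add_component vector_smult_component mult_1_left eqs ..
    qed
    ultimately show ?thesis by simp
  qed
  define a where "a n = complex_of_real ([Im (mobius_field K y (X - Z0) $ 3), 2 * Im (mobius_field K y (X - Z0) $ 2),
       Im (mobius_field K y (X - Z0) $ 1), 0, 0] ! n)" for n
  have "a 0 + a 1 * p + a 2 * p^2 + a 3 * p^3 + a 4 * p^4 = 0" if "\<bar>p - p0\<bar> < d" for p :: real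
    using zero[OF that] unfolding q_def a_def
    by (simp add: numeral_nat complex_eq_iff power2_eq_square algebra_simps)
  from quartic_zero_on_interval[OF d this] show ?thesis
    using exhaust_3[of k] by (auto simp: a_def numeral_nat)
qed

text \<open>A polynomial vanishing on \<open>i R^3\<close> vanishes identically, yet this one equals
  1 at \<open>X = Z0\<close>. It is affine plus a multiple of \<open>a * c - b^2\<close>, so five
  imaginary points suffice to determine it.\<close>

lemma mdet_nonzero_on_imaginary:
  obtains X where "\<And>j. Re (X $ j) = 0" "mdet K (X - Z0) \<noteq> 0"
proof (rule ccontr)
  note witness = that
  assume nt: "\<not> thesis"
  have z: "mdet K (X - Z0) = 0" if "\<And>j. Re (X $ j) = 0" for X
    using nt witness[OF that] by blast
  define g where "g a b c = mdet K (vector [a, b, c] - Z0)" for a b c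
  have zero: "g (\<i> * of_real a) (\<i> * of_real b) (\<i> * of_real c) = 0" for a b c
    unfolding g_def
  proof (rule z)
    fix j :: 3 show "Re (vector [\<i> * complex_of_real a, \<i> * complex_of_real b, \<i> * complex_of_real c] $ j) = 0"
      using exhaust_3[of j] by (auto simp: vector_3)
  qed
  define \<alpha> where "\<alpha> = g 0 0 0"
  define \<beta>1 where "\<beta>1 = K $ 1 - sdet K * Z0 $ 3"
  define \<beta>2 where "\<beta>2 = 2 * K $ 2 + 2 * sdet K * Z0 $ 2"
  define \<beta>3 where "\<beta>3 = K $ 3 - sdet K * Z0 $ 1"
  have g: "g a b c = \<alpha> + \<beta>1 * a + \<beta>2 * b + \<beta>3 * c + sdet K * (a * c - b^2)" for a b c
    unfolding \<alpha>_def g_def mdet_def sdet_def[of "_ - _"] vector_3 vector_minus_component \<beta>1_def \<beta>2_def \<beta>3_def by algebra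
  have \<alpha>: "\<alpha> = 0" using zero[of 0 0 0] by (simp add: \<alpha>_def)
  have 1: "\<beta>1 = 0" using zero[of 1 0 0] unfolding g \<alpha> by simp
  have 3: "\<beta>3 = 0" using zero[of 0 0 1] unfolding g \<alpha> by simp
  have 4: "sdet K = 0" using zero[of 1 0 1] unfolding g \<alpha> 1 3 by simp
  have 2: "\<beta>2 = 0" using zero[of 0 1 0] unfolding g \<alpha> 4 by simp
  have "g (Z0 $ 1) (Z0 $ 2) (Z0 $ 3) = 0" unfolding g \<alpha> 1 2 3 4 by simp
  moreover have "g (Z0 $ 1) (Z0 $ 2) (Z0 $ 3) = 1"
    unfolding g_def mdet_def sdet_def[of "_ - _"] vector_3 vector_minus_component by simp
  ultimately show False by simp
qed

text \<open>The symmetric matrix \<open>(1 + K W)\<^sup>-\<^sup>1 K\<close>.\<close>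

definition rebase :: "complex^3 \<Rightarrow> complex^3 \<Rightarrow> complex^3" where
  "rebase K W = vector [(K $ 1 + sdet K * W $ 3) / mdet K W, (K $ 2 - sdet K * W $ 2) / mdet K W,
     (K $ 3 + sdet K * W $ 1) / mdet K W]"

text \<open>Entries of \<open>(1 + K W) R = K\<close> for \<open>R = rebase K W\<close>; clearing
  the denominator leaves polynomial identities.\<close>

lemma rebase_eqs:
  assumes "mdet K W \<noteq> 0"
  shows "(1 + K $ 1 * W $ 1 + K $ 2 * W $ 2) * rebase K W $ 1 + (K $ 1 * W $ 2 + K $ 2 * W $ 3) * rebase K W $ 2 = K $ 1"
    "(1 + K $ 1 * W $ 1 + K $ 2 * W $ 2) * rebase K W $ 2 + (K $ 1 * W $ 2 + K $ 2 * W $ 3) * rebase K W $ 3 = K $ 2"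
    "(K $ 2 * W $ 1 + K $ 3 * W $ 2) * rebase K W $ 1 + (1 + K $ 2 * W $ 2 + K $ 3 * W $ 3) * rebase K W $ 2 = K $ 2"
    "(K $ 2 * W $ 1 + K $ 3 * W $ 2) * rebase K W $ 2 + (1 + K $ 2 * W $ 2 + K $ 3 * W $ 3) * rebase K W $ 3 = K $ 3"
proof -
  have "rebase K W $ 1 * mdet K W = K $ 1 + sdet K * W $ 3"
    "rebase K W $ 2 * mdet K W = K $ 2 - sdet K * W $ 2"
    "rebase K W $ 3 * mdet K W = K $ 3 + sdet K * W $ 1"
    using assms by (simp_all add: rebase_def vector_3)
  note e = this
  have can: "x = z" if "x * mdet K W = z * mdet K W" for x z using that assms by simp
  show "(1 + K $ 1 * W $ 1 + K $ 2 * W $ 2) * rebase K W $ 1 + (K $ 1 * W $ 2 + K $ 2 * W $ 3) * rebase K W $ 2 = K $ 1"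
    by (rule can) (simp only: distrib_right mult.assoc e, simp only: mdet_def sdet_def, algebra)
  show "(1 + K $ 1 * W $ 1 + K $ 2 * W $ 2) * rebase K W $ 2 + (K $ 1 * W $ 2 + K $ 2 * W $ 3) * rebase K W $ 3 = K $ 2"
    by (rule can) (simp only: distrib_right mult.assoc e, simp only: mdet_def sdet_def, algebra)
  show "(K $ 2 * W $ 1 + K $ 3 * W $ 2) * rebase K W $ 1 + (1 + K $ 2 * W $ 2 + K $ 3 * W $ 3) * rebase K W $ 2 = K $ 2"
    by (rule can) (simp only: distrib_right mult.assoc e, simp only: mdet_def sdet_def, algebra)
  show "(K $ 2 * W $ 1 + K $ 3 * W $ 2) * rebase K W $ 2 + (1 + K $ 2 * W $ 2 + K $ 3 * W $ 3) * rebase K W $ 3 = K $ 3"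
    by (rule can) (simp only: distrib_right mult.assoc e, simp only: mdet_def sdet_def, algebra)
qed

text \<open>Both claims rest on the factorisation
  \<open>1 + K (W + V) = (1 + K W) (1 + R V)\<close>, whose entries are the equations
  \<open>m\<close>.\<close>

lemma mobius_field_rebase:
  assumes "mdet K W \<noteq> 0"
  shows "mobius_field K y (W + V) = mobius_field (rebase K W) (mobius_field K y W) V"
    and "mdet K (W + V) = mdet K W * mdet (rebase K W) V"
proof -
  define R where "R = rebase K W"
  define a where "a = 1 + K $ 1 * W $ 1 + K $ 2 * W $ 2"
  define b where "b = K $ 1 * W $ 2 + K $ 2 * W $ 3"
  define c where "c = K $ 2 * W $ 1 + K $ 3 * W $ 2"
  define d where "d = 1 + K $ 2 * W $ 2 + K $ 3 * W $ 3"
  define a' where "a' = 1 + R $ 1 * V $ 1 + R $ 2 * V $ 2"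
  define b' where "b' = R $ 1 * V $ 2 + R $ 2 * V $ 3"
  define c' where "c' = R $ 2 * V $ 1 + R $ 3 * V $ 2"
  define d' where "d' = 1 + R $ 2 * V $ 2 + R $ 3 * V $ 3"
  note e = rebase_eqs[OF assms, folded R_def, folded a_def b_def c_def d_def]
  have m: "1 + K $ 1 * (W $ 1 + V $ 1) + K $ 2 * (W $ 2 + V $ 2) = a * a' + b * c'"
    "K $ 1 * (W $ 2 + V $ 2) + K $ 2 * (W $ 3 + V $ 3) = a * b' + b * d'"
    "K $ 2 * (W $ 1 + V $ 1) + K $ 3 * (W $ 2 + V $ 2) = c * a' + d * c'"
    "1 + K $ 2 * (W $ 2 + V $ 2) + K $ 3 * (W $ 3 + V $ 3) = c * b' + d * d'"
  proof -
    have "1 + K $ 1 * (W $ 1 + V $ 1) + K $ 2 * (W $ 2 + V $ 2) = a + K $ 1 * V $ 1 + K $ 2 * V $ 2"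
      by (simp add: a_def algebra_simps)
    then show "1 + K $ 1 * (W $ 1 + V $ 1) + K $ 2 * (W $ 2 + V $ 2) = a * a' + b * c'"
      unfolding a'_def c'_def using e(1,2) by algebra
    have "K $ 1 * (W $ 2 + V $ 2) + K $ 2 * (W $ 3 + V $ 3) = b + K $ 1 * V $ 2 + K $ 2 * V $ 3"
      by (simp add: b_def algebra_simps)
    then show "K $ 1 * (W $ 2 + V $ 2) + K $ 2 * (W $ 3 + V $ 3) = a * b' + b * d'"
      unfolding b'_def d'_def using e(1,2) by algebra
    have "K $ 2 * (W $ 1 + V $ 1) + K $ 3 * (W $ 2 + V $ 2) = c + K $ 2 * V $ 1 + K $ 3 * V $ 2"
      by (simp add: c_def algebra_simps)
    then show "K $ 2 * (W $ 1 + V $ 1) + K $ 3 * (W $ 2 + V $ 2) = c * a' + d * c'"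
      unfolding a'_def c'_def using e(3,4) by algebra
    have "1 + K $ 2 * (W $ 2 + V $ 2) + K $ 3 * (W $ 3 + V $ 3) = d + K $ 2 * V $ 2 + K $ 3 * V $ 3"
      by (simp add: d_def algebra_simps)
    then show "1 + K $ 2 * (W $ 2 + V $ 2) + K $ 3 * (W $ 3 + V $ 3) = c * b' + d * d'"
      unfolding b'_def d'_def using e(3,4) by algebra
  qed
  show "mobius_field K y (W + V) = mobius_field (rebase K W) (mobius_field K y W) V"
    unfolding mobius_field_def Let_def vector_add_component m R_def[symmetric] a'_def[symmetric] b'_def[symmetric]
      c'_def[symmetric] d'_def[symmetric] a_def[symmetric] b_def[symmetric] c_def[symmetric] d_def[symmetric]
    by (simp only: vec_eq_iff forall_3 vector_3, intro conjI; algebra)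
  show "mdet K (W + V) = mdet K W * mdet (rebase K W) V"
    unfolding mdet_eq vector_add_component m R_def[symmetric] a'_def[symmetric] b'_def[symmetric]
      c'_def[symmetric] d'_def[symmetric] a_def[symmetric] b_def[symmetric] c_def[symmetric] d_def[symmetric]
    by algebra
qed

lemma divide_has_derivative:
  fixes f g :: "complex^'n \<Rightarrow> complex"
  assumes "holo f V" "holo g V" "z \<in> V" "g z \<noteq> 0"
  shows "((\<lambda>z. f z / g z) has_derivative (\<lambda>h. \<Sum>i\<in>UNIV. (pd i f z * g z - f z * pd i g z) / (g z * g z) * h $ i)) (at z)"
proof -
  have "((\<Sum>i\<in>UNIV. pd i f z * h $ i) * g z - f z * (\<Sum>i\<in>UNIV. pd i g z * h $ i)) / (g z * g z)
      = (\<Sum>i\<in>UNIV. (pd i f z * g z - f z * pd i g z) / (g z * g z) * h $ i)" for h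
    unfolding sum_distrib_left sum_distrib_right sum_subtractf[symmetric] sum_divide_distrib
    by (rule sum.cong) (use assms(4) in \<open>auto simp: field_simps\<close>)
  then show ?thesis
    using has_derivative_divide'[OF holo_has_derivative[OF assms(1,3)] holo_has_derivative[OF assms(2,3)] assms(4)]
    by simp
qed

lemmas pd_divide = pd_eq[OF divide_has_derivative]

lemma holo_divide:
  assumes "holo f V" "holo g V" "\<And>z. z \<in> V \<Longrightarrow> g z \<noteq> 0"
  shows "holo (\<lambda>z. f z / g z) V"
  by (rule holoI, rule divide_has_derivative[OF assms(1,2)]) (use assms(3) in auto)

text \<open>For the identity matrix \<open>vector [1, 0, 1]\<close> the field at \<open>V\<close> is
  \<open>1 + V K + K V + V K K V\<close>. Its values at \<open>\<i>\<close> and \<open>-\<i>\<close>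
  times the identity differ by \<open>4 \<i> K\<close>, which has to be real.\<close>

lemma mobius_field_imaginary_parameter:
  assumes real: "\<And>b V k. (\<And>j. Re (V $ j) = 0) \<Longrightarrow> Im (mobius_field K (L b) V $ k) = 0"
    and basis: "\<And>k. (\<Sum>b\<in>UNIV. of_real (\<beta> b) * L b $ k) = vector [1, 0, 1] $ k"
  shows "Re (K $ j) = 0"
proof -
  let ?I = "vector [1, 0, 1] :: complex^3"
  have lin: "mobius_field K ?I V $ k = (\<Sum>b\<in>UNIV. of_real (\<beta> b) * mobius_field K (L b) V $ k)" for V k
  proof -
    have "mobius_field K ?I V $ 1 = (\<Sum>b\<in>UNIV. of_real (\<beta> b) * mobius_field K (L b) V $ 1)"
      "mobius_field K ?I V $ 2 = (\<Sum>b\<in>UNIV. of_real (\<beta> b) * mobius_field K (L b) V $ 2)"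
      "mobius_field K ?I V $ 3 = (\<Sum>b\<in>UNIV. of_real (\<beta> b) * mobius_field K (L b) V $ 3)"
      unfolding mobius_field_def Let_def vector_3(1)[of "_ * _ + _"] vector_3(2)[of "_ * _ + _"] vector_3(3)[of "_ * _ + _"]
        basis[symmetric] 
      by (simp_all add: sum_distrib_left sum.distrib[symmetric] algebra_simps)
    then show ?thesis using exhaust_3[of k] by auto
  qed
  have im: "Im (mobius_field K ?I V $ k) = 0" if "\<And>j. Re (V $ j) = 0" for V k
    unfolding lin using real[OF that] by simp
  have "Im (mobius_field K ?I (vector [\<i>, 0, \<i>]) $ k) = 0" for k
    by (rule im) (metis (no_types) exhaust_3 vector_3 imaginary_unit.sel(1) zero_complex.sel(1))
  moreover have "Im (mobius_field K ?I (vector [-\<i>, 0, -\<i>]) $ k) = 0" for k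
    by (rule im) (metis (no_types) exhaust_3 vector_3 imaginary_unit.sel(1) uminus_complex.sel(1) neg_equal_0_iff_equal zero_complex.sel(1))
  ultimately have "Im (mobius_field K ?I (vector [\<i>, 0, \<i>]) $ k - mobius_field K ?I (vector [-\<i>, 0, -\<i>]) $ k) = 0" for k
    by simp
  from this[of 1] this[of 2] this[of 3] show ?thesis
    using exhaust_3[of j] unfolding mobius_field_def Let_def vector_3
    by (auto simp: algebra_simps)
qed

text \<open>The symmetric matrix \<open>W (1 + K W)\<^sup>-\<^sup>1\<close>.\<close>

definition cayley :: "complex^3 \<Rightarrow> complex^3 \<Rightarrow> complex^3" where
  "cayley K W = vector [(W $ 1 + sdet W * K $ 3) / mdet K W, (W $ 2 - sdet W * K $ 2) / mdet K W,
     (W $ 3 + sdet W * K $ 1) / mdet K W]"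

text \<open>The derivative of \<open>W (1 + K W)^-1\<close> in direction \<open>a\<close> is
  \<open>(1 + W K)^-1 a (1 + K W)^-1\<close>, which is \<open>L\<close> for
  \<open>a = (1 + W K) L (1 + K W)\<close>.\<close>

lemma cayley_derivative:
  fixes u :: "complex^3 \<Rightarrow> complex^3"
  assumes u: "\<And>k. holo (\<lambda>z. u z $ k) U" and nz: "\<And>z. z \<in> U \<Longrightarrow> mdet K (u z) \<noteq> 0"
    and d: "\<And>z k. z \<in> U \<Longrightarrow> pd b (\<lambda>z. u z $ k) z = mobius_field K L (u z) $ k"
    and z: "z \<in> U"
  shows "pd b (\<lambda>z. cayley K (u z) $ k) z = L $ k"
proof -
  note hol = holo_add holo_diff holo_mult holo_const u
  note rules = pd_add[where V = U] pd_diff[where V = U] pd_mult[where V = U] hol z pd_const d[OF z]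
  have s: "holo (\<lambda>z. sdet (u z)) U" "holo (\<lambda>z. mdet K (u z)) U"
    unfolding mdet_def sdet_def power2_eq_square by (intro hol)+
  have *: "(x * m - n * y) / (m * m) = l" if "m \<noteq> 0" "x * m - n * y = l * (m * m)" for x m n y l :: complex
    using that by (simp add: field_simps)
  have "pd b (\<lambda>z. (u z $ 1 + sdet (u z) * K $ 3) / mdet K (u z)) z = L $ 1"
    by (subst pd_divide[where V = U]; (intro hol s z nz)?; rule *; (rule nz[OF z])?;
      unfold mdet_def sdet_def power2_eq_square; (simp only: rules)?;
      unfold mobius_field_def Let_def vector_3; algebra)
  moreover have "pd b (\<lambda>z. (u z $ 2 - sdet (u z) * K $ 2) / mdet K (u z)) z = L $ 2"
    by (subst pd_divide[where V = U]; (intro hol s z nz)?; rule *; (rule nz[OF z])?;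
      unfold mdet_def sdet_def power2_eq_square; (simp only: rules)?;
      unfold mobius_field_def Let_def vector_3; algebra)
  moreover have "pd b (\<lambda>z. (u z $ 3 + sdet (u z) * K $ 1) / mdet K (u z)) z = L $ 3"
    by (subst pd_divide[where V = U]; (intro hol s z nz)?; rule *; (rule nz[OF z])?;
      unfold mdet_def sdet_def power2_eq_square; (simp only: rules)?;
      unfold mobius_field_def Let_def vector_3; algebra)
  ultimately show ?thesis using exhaust_3[of k] by (auto simp: cayley_def vector_3)
qed

lemma holo_cayley:
  assumes u: "\<And>k. holo (\<lambda>z. u z $ k) U" and nz: "\<And>z. z \<in> U \<Longrightarrow> mdet K (u z) \<noteq> 0"
  shows "holo (\<lambda>z. cayley K (u z) $ k) U"
proof -
  note hol = holo_add holo_diff holo_mult holo_const u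
  have s: "holo (\<lambda>z. sdet (u z)) U" "holo (\<lambda>z. mdet K (u z)) U"
    unfolding mdet_def sdet_def power2_eq_square by (intro hol)+
  have "holo (\<lambda>z. (u z $ 1 + sdet (u z) * K $ 3) / mdet K (u z)) U"
    "holo (\<lambda>z. (u z $ 2 - sdet (u z) * K $ 2) / mdet K (u z)) U"
    "holo (\<lambda>z. (u z $ 3 + sdet (u z) * K $ 1) / mdet K (u z)) U"
    by (intro holo_divide hol s nz; assumption)+
  then show ?thesis using exhaust_3[of k] by (auto simp: cayley_def vector_3)
qed

text \<open>Let \<open>g = 1 + K W\<close> and let \<open>C\<close> be the image, so
  \<open>C g = W\<close>. For imaginary \<open>K\<close> the adjoint of \<open>g\<close> is
  \<open>h = 1 - cnj W K\<close>, whence \<open>h (C + cnj C) g = W + cnj W\<close>. This Hermitian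
  congruence of the real parts multiplies determinants by \<open>|det g|^2\<close> and sends zero to
  zero.\<close>

lemma cayley_Re:
  assumes K: "\<And>j. Re (K $ j) = 0" and nz: "mdet K W \<noteq> 0"
  defines "l \<equiv> \<chi> j. Re (cayley K W $ j)"
  shows "sdet l * (norm (mdet K W))^2 = sdet (\<chi> j. Re (W $ j))"
    and "l = 0 \<Longrightarrow> Re (W $ j) = 0"
proof -
  define a where "a = 1 + K $ 1 * W $ 1 + K $ 2 * W $ 2"
  define b where "b = K $ 1 * W $ 2 + K $ 2 * W $ 3"
  define c where "c = K $ 2 * W $ 1 + K $ 3 * W $ 2"
  define d where "d = 1 + K $ 2 * W $ 2 + K $ 3 * W $ 3"
  define C where "C = cayley K W"
  have D: "mdet K W = a * d - b * c" unfolding mdet_eq a_def b_def c_def d_def ..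
  have C: "C $ 1 * mdet K W = W $ 1 + sdet W * K $ 3" "C $ 2 * mdet K W = W $ 2 - sdet W * K $ 2"
    "C $ 3 * mdet K W = W $ 3 + sdet W * K $ 1"
    using nz by (simp_all add: C_def cayley_def vector_3)
  have can: "x = z" if "x * mdet K W = z * mdet K W" for x z using that nz by simp
  have CW: "C $ 1 * a + C $ 2 * c = W $ 1" "C $ 1 * b + C $ 2 * d = W $ 2" "C $ 2 * a + C $ 3 * c = W $ 2"
    "C $ 2 * b + C $ 3 * d = W $ 3"
  proof -
    have reord: "(x * y + z * v) * m = (x * m) * y + (z * m) * v" for x y z v m :: complex by algebra
    show "C $ 1 * a + C $ 2 * c = W $ 1"
      by (rule can) (simp only: reord C, simp only: a_def c_def mdet_def sdet_def, algebra)
    show "C $ 1 * b + C $ 2 * d = W $ 2"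
      by (rule can) (simp only: reord C, simp only: b_def d_def mdet_def sdet_def, algebra)
    show "C $ 2 * a + C $ 3 * c = W $ 2"
      by (rule can) (simp only: reord C, simp only: a_def c_def mdet_def sdet_def, algebra)
    show "C $ 2 * b + C $ 3 * d = W $ 3"
      by (rule can) (simp only: reord C, simp only: b_def d_def mdet_def sdet_def, algebra)
  qed
  have cK: "cnj (K $ j) = - K $ j" for j using K[of j] by (simp add: complex_eq_iff)
  have CW': "cnj (C $ 1) * cnj a + cnj (C $ 2) * cnj c = cnj (W $ 1)" "cnj (C $ 1) * cnj b + cnj (C $ 2) * cnj d = cnj (W $ 2)"
     "cnj (C $ 2) * cnj a + cnj (C $ 3) * cnj c = cnj (W $ 2)" "cnj (C $ 2) * cnj b + cnj (C $ 3) * cnj d = cnj (W $ 3)"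
    using CW[THEN arg_cong[where f = cnj]] by simp_all
  define s where "s j = C $ j + cnj (C $ j)" for j
  define w where "w j = W $ j + cnj (W $ j)" for j
  have abcd: "cnj a = 1 - K $ 1 * cnj (W $ 1) - K $ 2 * cnj (W $ 2)"
    "cnj b = - K $ 1 * cnj (W $ 2) - K $ 2 * cnj (W $ 3)"
    "cnj c = - K $ 2 * cnj (W $ 1) - K $ 3 * cnj (W $ 2)"
    "cnj d = 1 - K $ 2 * cnj (W $ 2) - K $ 3 * cnj (W $ 3)"
    by (simp_all add: a_def b_def c_def d_def cK)
  \<comment> \<open>The four entries of the congruence follow; \<open>s\<close> and \<open>w\<close>
    are twice the real parts.\<close>
  have "cnj a * (s 1 * a + s 2 * c) + cnj c * (s 2 * a + s 3 * c)
    = cnj a * (C $ 1 * a + C $ 2 * c) + cnj c * (C $ 2 * a + C $ 3 * c) +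
      (cnj (C $ 1) * cnj a + cnj (C $ 2) * cnj c) * a + (cnj (C $ 2) * cnj a + cnj (C $ 3) * cnj c) * c"
    unfolding s_def by algebra
  also have "\<dots> = w 1"
    unfolding CW CW' unfolding abcd unfolding a_def c_def w_def by algebra
  finally have e11: "cnj a * (s 1 * a + s 2 * c) + cnj c * (s 2 * a + s 3 * c) = w 1" .
  have "cnj a * (s 1 * b + s 2 * d) + cnj c * (s 2 * b + s 3 * d)
    = cnj a * (C $ 1 * b + C $ 2 * d) + cnj c * (C $ 2 * b + C $ 3 * d) +
      (cnj (C $ 1) * cnj a + cnj (C $ 2) * cnj c) * b + (cnj (C $ 2) * cnj a + cnj (C $ 3) * cnj c) * d"
    unfolding s_def by algebra
  also have "\<dots> = w 2"
    unfolding CW CW' unfolding abcd unfolding b_def d_def w_def by algebra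
  finally have e12: "cnj a * (s 1 * b + s 2 * d) + cnj c * (s 2 * b + s 3 * d) = w 2" .
  have "cnj b * (s 1 * a + s 2 * c) + cnj d * (s 2 * a + s 3 * c)
    = cnj b * (C $ 1 * a + C $ 2 * c) + cnj d * (C $ 2 * a + C $ 3 * c) +
      (cnj (C $ 1) * cnj b + cnj (C $ 2) * cnj d) * a + (cnj (C $ 2) * cnj b + cnj (C $ 3) * cnj d) * c"
    unfolding s_def by algebra
  also have "\<dots> = w 2"
    unfolding CW CW' unfolding abcd unfolding a_def c_def w_def by algebra
  finally have e21: "cnj b * (s 1 * a + s 2 * c) + cnj d * (s 2 * a + s 3 * c) = w 2" .
  have "cnj b * (s 1 * b + s 2 * d) + cnj d * (s 2 * b + s 3 * d)
    = cnj b * (C $ 1 * b + C $ 2 * d) + cnj d * (C $ 2 * b + C $ 3 * d) +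
      (cnj (C $ 1) * cnj b + cnj (C $ 2) * cnj d) * b + (cnj (C $ 2) * cnj b + cnj (C $ 3) * cnj d) * d"
    unfolding s_def by algebra
  also have "\<dots> = w 3"
    unfolding CW CW' unfolding abcd unfolding b_def d_def w_def by algebra
  finally have e22: "cnj b * (s 1 * b + s 2 * d) + cnj d * (s 2 * b + s 3 * d) = w 3" .
  have s: "s j = 2 * of_real (l $ j)" for j by (simp add: s_def l_def C_def complex_add_cnj)
  have w: "w j = 2 * of_real (Re (W $ j))" for j by (simp add: w_def complex_add_cnj)
  have "(s 1 * s 3 - s 2 * s 2) * ((a * d - b * c) * (cnj a * cnj d - cnj b * cnj c)) =
      (cnj a * (s 1 * a + s 2 * c) + cnj c * (s 2 * a + s 3 * c)) * (cnj b * (s 1 * b + s 2 * d) + cnj d * (s 2 * b + s 3 * d))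
      - (cnj a * (s 1 * b + s 2 * d) + cnj c * (s 2 * b + s 3 * d)) * (cnj b * (s 1 * a + s 2 * c) + cnj d * (s 2 * a + s 3 * c))"
    by algebra
  also have "\<dots> = w 1 * w 3 - w 2 * w 2" unfolding e11 e12 e21 e22 ..
  finally have "(s 1 * s 3 - s 2 * s 2) * (mdet K W * cnj (mdet K W)) = w 1 * w 3 - w 2 * w 2"
    by (simp add: D)
  then have "of_real (4 * (sdet l * (norm (mdet K W))^2)) = complex_of_real (4 * sdet (\<chi> j. Re (W $ j)))"
    unfolding complex_norm_square[symmetric] s w by (simp add: sdet_def power2_eq_square algebra_simps)
  then show "sdet l * (norm (mdet K W))^2 = sdet (\<chi> j. Re (W $ j))"
    unfolding of_real_eq_iff by simp
  assume "l = 0"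
  then have "s j = 0" for j by (simp add: s)
  then have "w 1 = 0" "w 2 = 0" "w 3 = 0" using e11 e12 e22 by simp_all
  then show "Re (W $ j) = 0" using exhaust_3[of j] by (auto simp: w)
qed

section \<open>Straightening\<close>

lemma inverse_Jacobian:
  fixes f :: "complex^'n \<Rightarrow> complex^'m" and g :: "complex^'m \<Rightarrow> complex^'n"
  assumes "\<And>k. holo (\<lambda>z. f z $ k) U" "\<And>k. holo (\<lambda>z. g z $ k) V" "open U"
    and "\<And>z. z \<in> U \<Longrightarrow> f z \<in> V" "\<And>z. z \<in> U \<Longrightarrow> g (f z) = z" "z \<in> U"
  shows "(\<Sum>i\<in>UNIV. pd i (\<lambda>Z. g Z $ k) (f z) * pd j (\<lambda>z. f z $ i) z) = (if k = j then 1 else 0)"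
proof -
  have "pd j (\<lambda>z. g (f z) $ k) z = (\<Sum>i\<in>UNIV. pd i (\<lambda>Z. g Z $ k) (f z) * pd j (\<lambda>z. f z $ i) z)"
    using pd_compose[OF assms(2,1,6) assms(4)[OF assms(6)]] by simp
  moreover have "pd j (\<lambda>z. g (f z) $ k) z = pd j (\<lambda>z. z $ k) z"
    by (rule pd_cong[OF assms(3,6)]) (simp add: assms(5))
  ultimately show ?thesis by auto
qed

text \<open>Along an imaginary translation \<open>Re F\<close> moves with velocity minus the
  imaginary part of the partial derivative. At \<open>t * (1, -p, p^2)\<close> the determinant has
  gradient \<open>t * (p^2, 2 * p, 1)\<close>, and it stays zero along the motion.\<close>

lemma translation_tangent_cone:
  assumes F: "\<And>k. holo (\<lambda>z. F z $ k) U" and z: "z \<in> U"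
    and inv: "\<forall>\<^sub>F s::real in nhds 0. F (z + axis b (\<i> * of_real s)) \<in> cone_tube"
    and p: "Re (F z $ 2) = - p * Re (F z $ 1)"
  shows "Im (of_real p ^ 2 * pd b (\<lambda>z. F z $ 1) z + 2 * of_real p * pd b (\<lambda>z. F z $ 2) z + pd b (\<lambda>z. F z $ 3) z) = 0"
proof -
  define y where "y k = pd b (\<lambda>z. F z $ k) z" for k
  let ?f = "\<lambda>k s. Re (F (z + axis b (\<i> * of_real s)) $ k)"
  have z0: "z + axis b (\<i> * of_real 0) = z" by (simp add: axis_def vec_eq_iff)
  have "F z \<in> cone_tube" using eventually_nhds_x_imp_x[OF inv] unfolding z0 .
  then have t: "Re (F z $ 1) \<noteq> 0" and "Re (F z $ 1) * Re (F z $ 3) = (Re (F z $ 2))^2"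
    by (auto simp: cone_tube_def)
  then have F3: "Re (F z $ 3) = p^2 * Re (F z $ 1)" unfolding p by (simp add: power2_eq_square field_simps)
  have d: "(?f k has_derivative (\<lambda>s. Re (y k * (\<i> * of_real s)))) (at 0)" for k
  proof -
    have "((\<lambda>t. F (z + axis b t) $ k) has_field_derivative y k) (at (\<i> * of_real 0))"
      using holo_along_axis[OF F, of z b "\<i> * of_real 0" k] z unfolding z0 y_def by simp
    then have "((\<lambda>t. F (z + axis b t) $ k) has_derivative (*) (y k)) (at (\<i> * of_real 0))"
      by (simp add: has_field_derivative_def)
    moreover have "((\<lambda>s::real. \<i> * of_real s) has_derivative (\<lambda>s. \<i> * of_real s)) (at 0)"
      by (auto intro!: derivative_eq_intros)
    ultimately show ?thesis
      by (intro has_derivative_Re) (rule has_derivative_compose[of "\<lambda>s::real. \<i> * of_real s" _ 0 UNIV])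
  qed
  have "((\<lambda>s. ?f 1 s * ?f 3 s - ?f 2 s * ?f 2 s) has_derivative
     (\<lambda>s. (?f 1 0 * Re (y 3 * (\<i> * of_real s)) + Re (y 1 * (\<i> * of_real s)) * ?f 3 0)
       - (?f 2 0 * Re (y 2 * (\<i> * of_real s)) + Re (y 2 * (\<i> * of_real s)) * ?f 2 0))) (at 0)"
    by (intro has_derivative_diff has_derivative_mult d)
  moreover have "((\<lambda>s. ?f 1 s * ?f 3 s - ?f 2 s * ?f 2 s) has_derivative (\<lambda>s. 0)) (at 0)"
  proof -
    obtain S where S: "open S" "0 \<in> S" "\<And>s. s \<in> S \<Longrightarrow> F (z + axis b (\<i> * of_real s)) \<in> cone_tube"
      using inv by (auto simp: eventually_nhds)
    then show ?thesis
      by (intro has_derivative_transform_within_open[OF has_derivative_const S(1,2)])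
        (auto simp: cone_tube_def power2_eq_square)
  qed
  ultimately have "(\<lambda>s. (?f 1 0 * Re (y 3 * (\<i> * of_real s)) + Re (y 1 * (\<i> * of_real s)) * ?f 3 0)
       - (?f 2 0 * Re (y 2 * (\<i> * of_real s)) + Re (y 2 * (\<i> * of_real s)) * ?f 2 0)) = (\<lambda>s. 0)"
    by (rule has_derivative_unique)
  from fun_cong[OF this, of 1]
  have "Re (F z $ 1) * (p^2 * Im (y 1) + 2 * p * Im (y 2) + Im (y 3)) = 0"
    unfolding z0 F3 p by (simp add: algebra_simps power2_eq_square)
  then have "p^2 * Im (y 1) + 2 * p * Im (y 2) + Im (y 3) = 0" using t by simp
  then show ?thesis unfolding y_def by (simp add: power2_eq_square)
qed

lemma mobius_field_linear:
  "mobius_field K Y W $ k = (\<Sum>l\<in>UNIV. mobius_field K (axis l 1) W $ k * Y $ l)"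
proof -
  have "mobius_field K Y W $ 1 = (\<Sum>l\<in>UNIV. mobius_field K (axis l 1) W $ 1 * Y $ l)"
    "mobius_field K Y W $ 2 = (\<Sum>l\<in>UNIV. mobius_field K (axis l 1) W $ 2 * Y $ l)"
    "mobius_field K Y W $ 3 = (\<Sum>l\<in>UNIV. mobius_field K (axis l 1) W $ 3 * Y $ l)"
    unfolding mobius_field_def Let_def vector_3 sum_3 by (simp_all add: axis_def)
  then show ?thesis using exhaust_3[of k] by auto
qed

text \<open>The \<open>Y b\<close> are the coordinate fields transported by \<open>F\<close>.
  Reality is stated at imaginary \<open>X\<close> because the base point will be moved
  there.\<close>

lemma translation_fields_mobius:
  fixes F h :: "complex^3 \<Rightarrow> complex^3"
  assumes U: "open U" and V: "open V"
    and F: "\<And>k. holo (\<lambda>z. F z $ k) U" and h: "\<And>k. holo (\<lambda>Z. h Z $ k) V"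
    and FU: "\<And>z. z \<in> U \<Longrightarrow> F z \<in> V" and hV: "\<And>Z. Z \<in> V \<Longrightarrow> h Z \<in> U"
    and hF: "\<And>z. z \<in> U \<Longrightarrow> h (F z) = z" and Fh: "\<And>Z. Z \<in> V \<Longrightarrow> F (h Z) = Z"
    and z0: "z0 \<in> U" "F z0 \<in> cone_tube"
    and inv: "\<And>z b. z \<in> U \<Longrightarrow> F z \<in> cone_tube \<Longrightarrow> \<forall>\<^sub>F s::real in nhds 0. F (z + axis b (\<i> * of_real s)) \<in> cone_tube"
    and Y_def: "\<And>b Z. Y b Z = (\<chi> k. pd b (\<lambda>z. F z $ k) (h Z))"
  obtains K r where "r > 0" "ball (F z0) r \<subseteq> V"
    "\<And>Z b. Z \<in> ball (F z0) r \<Longrightarrow> Y b Z = mobius_field K (Y b (F z0)) (Z - F z0)"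
    "\<forall>X. (\<forall>j. Re (X $ j) = 0) \<longrightarrow> (\<forall>b k. Im (mobius_field K (Y b (F z0)) (X - F z0) $ k) = 0)"
proof -
  have Y: "holo (\<lambda>Z. Y b Z $ k) V" for b k
    unfolding Y_def vec_lambda_beta by (rule holo_compose[OF holo_pd[OF F U] h hV])
  have inv1: "(\<Sum>b\<in>UNIV. Y b Z $ k * pd j (\<lambda>Z. h Z $ b) Z) = (if k = j then 1 else 0)" if "Z \<in> V" for Z j k
    using inverse_Jacobian[OF h F V hV Fh that] by (simp add: Y_def)
  have inv2: "(\<Sum>i\<in>UNIV. pd i (\<lambda>Z. h Z $ b) Z * Y c Z $ i) = (if b = c then 1 else 0)" if "Z \<in> V" for Z b c
    using inverse_Jacobian[OF F h U FU hF hV[OF that]] by (simp add: Y_def Fh[OF that])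
  have tan: "Im (of_real p ^ 2 * Y b Z $ 1 + 2 * of_real p * Y b Z $ 2 + Y b Z $ 3) = 0"
    if "Z \<in> V" "Z \<in> cone_tube" "Re (Z $ 2) = - p * Re (Z $ 1)" for Z p b
    using translation_tangent_cone[OF F hV[OF that(1)] inv[OF hV[OF that(1)]], of p b] that(2,3)
    by (simp add: Y_def Fh[OF that(1)])
  let ?CK = "\<lambda>b Z. pd 1 (\<lambda>Z. Y b Z $ 3) Z = 0 \<and>
     2 * pd 1 (\<lambda>Z. Y b Z $ 2) Z = pd 2 (\<lambda>Z. Y b Z $ 3) Z \<and>
     pd 1 (\<lambda>Z. Y b Z $ 1) Z - 2 * pd 2 (\<lambda>Z. Y b Z $ 2) Z + pd 3 (\<lambda>Z. Y b Z $ 3) Z = 0 \<and>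
     2 * pd 3 (\<lambda>Z. Y b Z $ 2) Z = pd 2 (\<lambda>Z. Y b Z $ 1) Z \<and>
     pd 3 (\<lambda>Z. Y b Z $ 1) Z = 0"
  have "\<forall>b. \<exists>r>0. ball (F z0) r \<subseteq> V \<and> (\<forall>Z\<in>ball (F z0) r. ?CK b Z)"
    by (intro allI conformal_Killing_equations[OF Y V FU[OF z0(1)] z0(2)]) (use tan in auto)
  then obtain rr where rr: "\<And>b. rr b > 0" "\<And>b. ball (F z0) (rr b) \<subseteq> V" "\<And>b Z. Z \<in> ball (F z0) (rr b) \<Longrightarrow> ?CK b Z"
    by metis
  define r where "r = Min (range rr)"
  have r: "r > 0" "\<And>b. r \<le> rr b" using rr(1) by (auto simp: r_def)
  define N where "N = ball (F z0) r"
  have NV: "N \<subseteq> V" using rr(2)[of 1] r(2)[of 1] by (auto simp: N_def)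
  have CK: "?CK b Z" if "Z \<in> N" for b Z
    by (rule rr(3)) (use that r(2)[of b] in \<open>auto simp: N_def\<close>)
  have oN: "open N" and cN: "convex N" and Z0N: "F z0 \<in> N" using r by (auto simp: N_def)
  have YN: "holo (\<lambda>Z. Y b Z $ k) N" for b k by (rule holo_subset[OF Y NV])
  have hN: "holo (\<lambda>Z. h Z $ k) N" for k by (rule holo_subset[OF h NV])
  obtain K where K: "\<And>k. holo (\<lambda>Z. K Z $ k) N" "\<And>b. conformal_system K (Y b) N"
    by (rule conformal_system_exists[OF oN YN hN inv1 inv2 CK]) (use NV in auto)
  have inde: "a1 = 0 \<and> a2 = 0 \<and> a3 = 0"
    if "Z \<in> N" and a: "\<And>b. a1 * Y b Z $ 1 + a2 * Y b Z $ 2 + a3 * Y b Z $ 3 = 0" for Z a1 a2 a3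
  proof -
    have "(\<Sum>b\<in>UNIV. (a1 * Y b Z $ 1 + a2 * Y b Z $ 2 + a3 * Y b Z $ 3) * pd j (\<lambda>Z. h Z $ b) Z) =
       a1 * (if 1 = j then 1 else 0) + a2 * (if 2 = j then 1 else 0) + a3 * (if 3 = j then 1 else 0)" for j
      unfolding inv1[OF subsetD[OF NV that(1)], symmetric] sum_distrib_left sum.distrib[symmetric]
      by (rule sum.cong) (auto simp: algebra_simps)
    from this[of 1] this[of 2] this[of 3] show ?thesis unfolding a by simp
  qed
  note ric = conformal_system_Riccati[OF oN YN K(1) inde K(2)]
  have sol: "Y b Z = mobius_field (K (F z0)) (Y b (F z0)) (Z - F z0)" if "Z \<in> N" for b Z
    by (rule conformal_system_solution[OF cN Z0N YN K(1,2) ric that])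
  have real: "Im (of_real p ^ 2 * mobius_field (K (F z0)) (Y b (F z0)) (Z - F z0) $ 1
      + 2 * of_real p * mobius_field (K (F z0)) (Y b (F z0)) (Z - F z0) $ 2 + mobius_field (K (F z0)) (Y b (F z0)) (Z - F z0) $ 3) = 0"
    if "Z \<in> ball (F z0) r" "Z \<in> cone_tube" "Re (Z $ 2) = - p * Re (Z $ 1)" for Z p b
    using tan[of Z p b] that NV unfolding sol[of Z b, unfolded N_def, OF that(1)] by (auto simp: N_def)
  show ?thesis
  proof (rule that[of r "K (F z0)"])
    show "r > 0" "ball (F z0) r \<subseteq> V" using r NV by (auto simp: N_def)
    show "\<And>Z b. Z \<in> ball (F z0) r \<Longrightarrow> Y b Z = mobius_field (K (F z0)) (Y b (F z0)) (Z - F z0)"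
      using sol by (simp add: N_def)
    have "Im (mobius_field (K (F z0)) (Y b (F z0)) (X - F z0) $ k) = 0" if X: "\<And>j. Re (X $ j) = 0" for X b k
      by (rule mobius_field_real_on_imaginary[OF r(1) z0(2) real X])
    then show "\<forall>X. (\<forall>j. Re (X $ j) = 0) \<longrightarrow> (\<forall>b k. Im (mobius_field (K (F z0)) (Y b (F z0)) (X - F z0) $ k) = 0)"
      by simp
  qed
qed

lemma real_matrix_invertible:
  fixes L M E :: "complex^'n^'n"
  assumes "M ** (L ** E) = mat 1" and L: "\<And>k b. L $ k $ b = of_real (A $ k $ b)"
  shows "invertible (A :: real^'n^'n)"
proof -
  have "L ** (E ** M) = mat 1"
    using assms(1) matrix_left_right_inverse[of M "L ** E"] by (simp add: matrix_mul_assoc)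
  then have "det L * det (E ** M) = 1" 
    using det_mul[of L "E ** M"] by simp
  then have "det L \<noteq> 0" by auto
  moreover have "det L = of_real (det A)" by (simp add: det_def L)
  ultimately show ?thesis by (simp add: invertible_det_nz)
qed

text \<open>The affine map is the real part of the straightened map
  \<open>cayley R (F z - X)\<close>. The last conclusion keeps the base point away from the apex of
  the cone.\<close>

lemma cone_tube_straightening:
  fixes F h :: "complex^3 \<Rightarrow> complex^3"
  assumes U: "open U" and V: "open V"
    and F: "\<And>k. holo (\<lambda>z. F z $ k) U" and h: "\<And>k. holo (\<lambda>Z. h Z $ k) V"
    and FU: "\<And>z. z \<in> U \<Longrightarrow> F z \<in> V" and hV: "\<And>Z. Z \<in> V \<Longrightarrow> h Z \<in> U"
    and hF: "\<And>z. z \<in> U \<Longrightarrow> h (F z) = z" and Fh: "\<And>Z. Z \<in> V \<Longrightarrow> F (h Z) = Z"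
    and z0: "z0 \<in> U" "F z0 \<in> cone_tube"
    and inv: "\<And>z b. z \<in> U \<Longrightarrow> F z \<in> cone_tube \<Longrightarrow> \<forall>\<^sub>F s::real in nhds 0. F (z + axis b (\<i> * of_real s)) \<in> cone_tube"
  obtains A :: "real^3^3" and c r where "invertible A" "r > 0" "ball z0 r \<subseteq> U"
    "\<And>z. z \<in> ball z0 r \<Longrightarrow> sdet (A *v (\<chi> i. Re (z $ i)) + c) = 0 \<longleftrightarrow> sdet (\<chi> i. Re (F z $ i)) = 0"
    "\<And>z i. z \<in> ball z0 r \<Longrightarrow> A *v (\<chi> i. Re (z $ i)) + c = 0 \<Longrightarrow> Re (F z $ i) = 0"
proof -
  define Y where "Y b Z = (\<chi> k. pd b (\<lambda>z. F z $ k) (h Z))" for b Z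
  obtain K r0 where r0: "r0 > 0" "ball (F z0) r0 \<subseteq> V"
    and sol: "\<And>Z b. Z \<in> ball (F z0) r0 \<Longrightarrow> Y b Z = mobius_field K (Y b (F z0)) (Z - F z0)"
    and real': "\<forall>X. (\<forall>j. Re (X $ j) = 0) \<longrightarrow> (\<forall>b k. Im (mobius_field K (Y b (F z0)) (X - F z0) $ k) = 0)"
    apply (rule translation_fields_mobius[OF U V F h FU hV hF Fh z0 inv Y_def]; assumption?)
    subgoal premises prems by (rule prems(1)[OF prems(2-5)])
    done
  have real: "Im (mobius_field K (Y b (F z0)) (X - F z0) $ k) = 0" if "\<And>j. Re (X $ j) = 0" for X b k
    using real' that by blast
  \<comment> \<open>At an imaginary \<open>X\<close> the fields are real, and subtracting
    \<open>X\<close> does not change \<open>Re (F z)\<close>.\<close>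
  obtain X where X: "\<And>j. Re (X $ j) = 0" "mdet K (X - F z0) \<noteq> 0"
    using mdet_nonzero_on_imaginary[of K "F z0"] by metis
  define R where "R = rebase K (X - F z0)"
  define L where "L b = mobius_field K (Y b (F z0)) (X - F z0)" for b
  have rb: "mobius_field K (Y b (F z0)) (Z - F z0) = mobius_field R (L b) (Z - X)" for b Z
    using mobius_field_rebase(1)[OF X(2), of "Y b (F z0)" "Z - X"] by (simp add: R_def L_def)
  \<comment> \<open>Multiplicativity for the displacement from \<open>F z0\<close> to
    \<open>X\<close> and back: the product of the two determinants is
    \<open>mdet K 0\<close>.\<close>
  have "mdet K 0 = 1" by (simp add: mdet_def sdet_def)
  then have nz: "mdet R (F z0 - X) \<noteq> 0"
    using mobius_field_rebase(2)[OF X(2), of "F z0 - X"] by (auto simp: R_def)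
  have LX: "mobius_field R (L b) V = mobius_field K (Y b (F z0)) ((V + X) - F z0)" for b V
    using rb[of b "V + X"] by simp
  have Lreal: "Im (mobius_field R (L b) V $ k) = 0" if "\<And>j. Re (V $ j) = 0" for b V k
    unfolding LX by (rule real) (simp add: that X)
  have "mobius_field R (L b) 0 = L b" for b
    by (simp add: mobius_field_def Let_def vec_eq_iff forall_3 vector_3)
  then have Lr: "Im (L b $ k) = 0" for b k using Lreal[of 0 b k] by simp
  define A where "A = (\<chi> k b. Re (L b $ k))"
  have LA: "L b $ k = of_real (A $ k $ b)" for b k using Lr[of b k] by (simp add: A_def complex_eq_iff)
  have A: "invertible A"
  proof (rule real_matrix_invertible)
    let ?M = "\<chi> k l. mobius_field R (axis l 1) (F z0 - X) $ k"
    let ?L = "\<chi> k b. L b $ k"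
    let ?E = "\<chi> b j. pd j (\<lambda>Z. h Z $ b) (F z0)"
    \<comment> \<open>\<open>?M\<close> maps the constants \<open>L b\<close> to the values
      \<open>Y b (F z0)\<close>, which form the Jacobian of \<open>F\<close>; its inverse is
      \<open>?E\<close>.\<close>
    show "?M ** (?L ** ?E) = mat 1"
    proof -
      have "mobius_field R (L b) (F z0 - X) = Y b (F z0)" for b
        using rb[of b "F z0"] by (simp add: mobius_field_def Let_def vec_eq_iff forall_3 vector_3)
      then have "?M ** ?L = (\<chi> k b. Y b (F z0) $ k)"
        by (simp add: vec_eq_iff matrix_matrix_mult_def mobius_field_linear[of R "L _", symmetric])
      moreover have "(\<chi> k b. Y b (F z0) $ k) ** ?E = mat 1"
        using inverse_Jacobian[OF h F V hV Fh FU[OF z0(1)]]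
        by (simp add: vec_eq_iff matrix_matrix_mult_def mat_def Y_def)
      ultimately show ?thesis by (simp add: matrix_mul_assoc)
    qed
    show "?L $ k $ b = of_real (A $ k $ b)" for k b by (simp add: LA)
  qed
  \<comment> \<open>Invertibility makes the identity matrix \<open>[1, 0, 1]\<close> a real
    combination of the \<open>L b\<close>.\<close>
  obtain A' where "A ** A' = mat 1" using A by (auto simp: invertible_def)
  then have "A *v (A' *v vector [1, 0, 1]) = vector [1, 0, 1]" by (simp add: matrix_vector_mul_assoc)
  then have "(\<Sum>b\<in>UNIV. A $ k $ b * (A' *v vector [1, 0, 1]) $ b) = vector [1, 0, 1] $ k" for k
    by (simp add: vec_eq_iff matrix_vector_mult_def)
  then have "(\<Sum>b\<in>UNIV. of_real ((A' *v vector [1, 0, 1]) $ b) * L b $ k) = of_real (vector [1, 0, 1] $ k)" for k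
    by (simp only: LA of_real_mult[symmetric] of_real_sum[symmetric] mult.commute[of "(A' *v vector [1, 0, 1]) $ _"])
  moreover have "of_real (vector [1, 0, 1] $ k) = (vector [1, 0, 1] :: complex^3) $ k" for k :: 3
    using exhaust_3[of k] by (auto simp: vector_3)
  ultimately have basis: "(\<Sum>b\<in>UNIV. of_real ((A' *v vector [1, 0, 1]) $ b) * L b $ k) = vector [1, 0, 1] $ k" for k
    by simp
  have R: "Re (R $ j) = 0" for j
    by (rule mobius_field_imaginary_parameter[OF Lreal basis])
  define u where "u z = F z - X" for z
  have uh: "holo (\<lambda>z. u z $ k) U" for k
    unfolding u_def vector_minus_component by (intro holo_diff F holo_const)
  have mh: "holo (\<lambda>z. mdet R (u z)) U"
    unfolding mdet_def sdet_def power2_eq_square by (intro holo_add holo_diff holo_mult holo_const uh)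
  have cF: "continuous_on U F" by (rule continuous_on_from_holo[OF F])
  have "open (F -` ball (F z0) r0 \<inter> U)" "open ((\<lambda>z. mdet R (u z)) -` (- {0}) \<inter> U)"
    using cF holo_continuous_on[OF mh] U by (auto simp: continuous_on_open_vimage)
  then have "open (F -` ball (F z0) r0 \<inter> U \<inter> ((\<lambda>z. mdet R (u z)) -` (- {0}) \<inter> U))" by (rule open_Int)
  moreover have "z0 \<in> F -` ball (F z0) r0 \<inter> U \<inter> ((\<lambda>z. mdet R (u z)) -` (- {0}) \<inter> U)"
    using z0 r0 nz by (simp add: u_def)
  ultimately obtain r where r: "r > 0"
    and sub: "ball z0 r \<subseteq> F -` ball (F z0) r0 \<inter> U \<inter> ((\<lambda>z. mdet R (u z)) -` (- {0}) \<inter> U)"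
    by (meson open_contains_ball)
  define B where "B = ball z0 r"
  have BU: "B \<subseteq> U" and Bnz: "\<And>z. z \<in> B \<Longrightarrow> mdet R (u z) \<noteq> 0" and BF: "\<And>z. z \<in> B \<Longrightarrow> F z \<in> ball (F z0) r0"
    using sub by (auto simp: B_def)
  have oB: "open B" "convex B" "z0 \<in> B" using r by (auto simp: B_def)
  have uB: "holo (\<lambda>z. u z $ k) B" for k by (rule holo_subset[OF uh BU])
  have pdu: "pd b (\<lambda>z. u z $ k) z = mobius_field R (L b) (u z) $ k" if z: "z \<in> B" for b k z
  proof -
    have "pd b (\<lambda>z. u z $ k) z = pd b (\<lambda>z. F z $ k) z"
      unfolding u_def vector_minus_component using z BU by (subst pd_diff[where V = U]) (auto intro: F)
    also have "\<dots> = Y b (F z) $ k" using z BU hF by (auto simp: Y_def)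
    also have "\<dots> = mobius_field R (L b) (u z) $ k" unfolding sol[OF BF[OF z]] rb u_def ..
    finally show ?thesis .
  qed
  have cd: "pd b (\<lambda>z. cayley R (u z) $ k) z = L b $ k" if z: "z \<in> B" for b k z
    by (rule cayley_derivative[OF uB Bnz pdu z])
  have ch: "holo (\<lambda>z. cayley R (u z) $ k) B" for k by (rule holo_cayley[OF uB Bnz])
  define C where "C k = cayley R (u z0) $ k - (\<Sum>b\<in>UNIV. L b $ k * z0 $ b)" for k
  have C: "cayley R (u z) $ k = (\<Sum>b\<in>UNIV. L b $ k * z $ b) + C k" if z: "z \<in> B" for z k
  proof -
    have hs: "holo (\<lambda>z. \<Sum>b\<in>UNIV. L b $ k * z $ b) B" by (intro holo_sum holo_mult holo_const holo_coord) auto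
    have "cayley R (u z) $ k - (\<Sum>b\<in>UNIV. L b $ k * z $ b) = C k"
      unfolding C_def
    proof (rule pd_zero_constant[OF holo_diff[OF ch hs] oB(2) _ z oB(3)])
      fix w i assume w: "w \<in> B"
      show "pd i (\<lambda>z. cayley R (u z) $ k - (\<Sum>b\<in>UNIV. L b $ k * z $ b)) w = 0"
        unfolding pd_diff[OF ch hs w] cd[OF w] using w
        by (subst pd_sum[where V = B]) (auto simp: pd_mult[where V = B] holo_const holo_coord if_distrib intro!: holo_mult cong: if_cong)
    qed
    then show ?thesis by (simp add: algebra_simps)
  qed
  define c where "c = (\<chi> k. Re (C k))"
  have l: "(\<chi> j. Re (cayley R (u z) $ j)) = A *v (\<chi> i. Re (z $ i)) + c" if "z \<in> B" for z
    by (simp add: vec_eq_iff C[OF that] c_def matrix_vector_mult_def LA)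
  have ReX: "(\<chi> j. Re (u z $ j)) = (\<chi> j. Re (F z $ j))" for z by (simp add: vec_eq_iff u_def X)
  show ?thesis
  proof (rule that[OF A r])
    show "ball z0 r \<subseteq> U" using BU by (simp add: B_def)
    fix z assume "z \<in> ball z0 r"
    then have z: "z \<in> B" by (simp add: B_def)
    note cr = cayley_Re[OF R Bnz[OF z], unfolded l[OF z] ReX]
    show "sdet (A *v (\<chi> i. Re (z $ i)) + c) = 0 \<longleftrightarrow> sdet (\<chi> i. Re (F z $ i)) = 0"
      using cr(1) Bnz[OF z] by (metis mult_eq_0_iff norm_eq_zero power_eq_0_iff)
    show "A *v (\<chi> i. Re (z $ i)) + c = 0 \<Longrightarrow> Re (F z $ i) = 0" for i
      using cr(2)[of i] by (simp add: u_def X)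
  qed
qed

section \<open>Tubes and affine maps\<close>

definition re :: "complex^3 \<Rightarrow> real^3" where
  "re z = (\<chi> i. Re (z $ i))"

definition cplx :: "real^3 \<Rightarrow> complex^3" where
  "cplx x = (\<chi> i. of_real (x $ i))"

lemma continuous_re: "continuous_on A re"
  unfolding re_def[abs_def] by (intro continuous_intros)

lemma continuous_cplx: "continuous_on A cplx"
  unfolding cplx_def[abs_def] by (intro continuous_intros)

lemma re_cplx [simp]: "re (cplx x) = x"
  by (simp add: re_def cplx_def vec_eq_iff)

lemma tube_re: "tube S = re -` S"
  by (auto simp: tube_def re_def)

lemma model_hypersurface_tube: "model_hypersurface = tube model_surface"
  by (auto simp: model_hypersurface_def tube_def model_surface_def)

lemma openin_tube:
  assumes "openin (top_of_set S) X"
  shows "openin (top_of_set (tube S)) (tube X)"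
proof -
  obtain T where "open T" "X = S \<inter> T" using assms by (auto simp: openin_open)
  moreover have "open (re -` T)"
    using open_vimage[OF \<open>open T\<close> continuous_re] .
  ultimately show ?thesis by (auto simp: openin_open tube_re)
qed

lemma complexified_affine_biholomorphic:
  fixes b :: "real^3"
  assumes "A ** A' = (mat 1 :: real^3^3)" "A' ** A = mat 1"
  defines "f \<equiv> \<lambda>z. (\<chi> i j. of_real (A $ i $ j)) *v z + cplx b"
    and "g \<equiv> \<lambda>z. (\<chi> i j. of_real (A' $ i $ j)) *v (z - cplx b)"
  shows "biholomorphic3 UNIV UNIV f" "\<And>z. re (f z) = A *v re z + b" "\<And>z. f (g z) = z"
proof -
  let ?C = "\<lambda>A :: real^3^3. (\<chi> i j. of_real (A $ i $ j)) :: complex^3^3"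
  have C: "?C A ** ?C B = ?C (A ** B)" for A B
    by (simp add: vec_eq_iff matrix_matrix_mult_def)
  have C1: "?C (mat 1) = mat 1" by (simp add: vec_eq_iff mat_def)
  show fg: "f (g z) = z" for z
    by (simp add: f_def g_def matrix_vector_mul_assoc C assms C1)
  have gf: "g (f z) = z" for z
    by (simp add: f_def g_def matrix_vector_mul_assoc C assms C1)
  have bij: "bij f" using fg gf by (intro o_bij[of g]) (auto simp: fun_eq_iff)
  have inv: "inv f = g" using fg gf by (intro inv_unique_comp) (auto simp: fun_eq_iff)
  have "(f has_derivative (\<lambda>h. ?C A *v h)) (at z)" "(g has_derivative (\<lambda>h. ?C A' *v h)) (at z)" for z
    unfolding f_def g_def
    by (auto intro!: derivative_eq_intros bounded_linear.has_derivative[OF matrix_vector_mul_bounded_linear])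
  then show "biholomorphic3 UNIV UNIV f"
    unfolding biholomorphic3_def holomorphic3_on_def inv using bij by blast
  show "re (f z) = A *v re z + b" for z
    by (simp add: f_def re_def cplx_def vec_eq_iff matrix_vector_mult_def)
qed

text \<open>The complexified map has a real matrix, so taking real parts turns it into the given
  affine map, and it carries tubes to tubes.\<close>

lemma affine_equivalent_imp_tubes_biholomorphic:
  assumes "locally_equivalent affine_transformations S N"
  shows "locally_equivalent local_biholomorphisms (tube S) (tube N)"
  unfolding locally_equivalent_def
proof
  fix p assume "p \<in> tube S"
  then have "re p \<in> S" by (simp add: tube_re)
  then obtain X f where X: "openin (top_of_set S) X" "re p \<in> X" and f: "f \<in> Aff3" "openin (top_of_set N) (f ` X)"
    using assms unfolding locally_equivalent_def affine_transformations_def by fastforce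
  obtain A b where A: "invertible A" and fA: "f = (\<lambda>x. A *v x + b)" using f by (auto simp: Aff3_def)
  obtain A' where A': "A ** A' = mat 1" "A' ** A = mat 1" using A by (auto simp: invertible_def)
  define F where "F z = (\<chi> i j. of_real (A $ i $ j)) *v z + cplx b" for z
  define G where "G z = (\<chi> i j. of_real (A' $ i $ j)) *v (z - cplx b)" for z
  note cab = complexified_affine_biholomorphic[OF A', where b = b, folded F_def G_def, folded F_def[abs_def]]
  have "F ` tube X = tube (f ` X)"
  proof
    show "F ` tube X \<subseteq> tube (f ` X)" using cab(2) by (auto simp: tube_re fA)
    show "tube (f ` X) \<subseteq> F ` tube X"
    proof
      fix w assume "w \<in> tube (f ` X)"
      then obtain x where x: "x \<in> X" "re w = A *v x + b" by (auto simp: tube_re fA)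
      have "A *v re (G w) + b = A *v x + b" using cab(2)[of "G w"] cab(3)[of w] x by simp
      then have "A' *v (A *v re (G w)) = A' *v (A *v x)" by simp
      then have "re (G w) = x" by (simp add: matrix_vector_mul_assoc A')
      then have "G w \<in> tube X" using x by (simp add: tube_re)
      then show "w \<in> F ` tube X" using cab(3)[of w] by (metis image_eqI)
    qed
  qed
  then have "openin (top_of_set (tube N)) (F ` tube X)" using openin_tube[OF f(2)] by simp
  moreover have "(UNIV, F) \<in> local_biholomorphisms"
    using cab(1) by (auto simp: local_biholomorphisms_def)
  ultimately show "\<exists>X. openin (top_of_set (tube S)) X \<and> p \<in> X \<and>
      (\<exists>(U, f)\<in>local_biholomorphisms. X \<subseteq> U \<and> openin (top_of_set (tube N)) (f ` X))"
    using openin_tube[OF X(1)] X(2) by (intro exI[of _ "tube X"]) (auto simp: tube_re)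
qed

section \<open>From a local biholomorphism of tubes to a real affine map\<close>

lemma holo_component:
  assumes "holomorphic3_on f U"
  shows "holo (\<lambda>z. f z $ k) U"
  unfolding holo_def
proof
  fix z assume "z \<in> U"
  then obtain J where "(f has_derivative (\<lambda>h. J *v h)) (at z)" using assms by (auto simp: holomorphic3_on_def)
  from bounded_linear.has_derivative[OF bounded_linear_vec_nth this, of k]
  have "((\<lambda>z. f z $ k) has_derivative (\<lambda>h. \<Sum>i\<in>UNIV. (\<lambda>i. J $ k $ i) i * h $ i)) (at z)"
    by (simp add: matrix_vector_mult_def)
  then show "\<exists>a. ((\<lambda>z. f z $ k) has_derivative (\<lambda>h. \<Sum>i\<in>UNIV. a i * h $ i)) (at z)"
    by (intro exI[of _ "\<lambda>i. J $ k $ i"]) simp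
qed

lemma holomorphic3_continuous_on: "holomorphic3_on f U \<Longrightarrow> continuous_on U f"
  unfolding holomorphic3_on_def
  by (meson continuous_at_imp_continuous_on has_derivative_continuous)

lemma open_affine_image:
  fixes A :: "real^3^3"
  assumes "A ** A' = mat 1" "A' ** A = mat 1" "open S"
  shows "open ((\<lambda>x. A *v x + b) ` S)"
proof -
  have "(\<lambda>x. A *v x + b) ` S = (\<lambda>y. A' *v (y - b)) -` S"
  proof (intro equalityI subsetI)
    fix y assume "y \<in> (\<lambda>y. A' *v (y - b)) -` S"
    then show "y \<in> (\<lambda>x. A *v x + b) ` S"
      by (intro image_eqI[of _ _ "A' *v (y - b)"]) (auto simp: matrix_vector_mul_assoc assms)
  qed (auto simp: matrix_vector_mul_assoc assms)
  moreover have "continuous_on UNIV (\<lambda>y. A' *v (y - b))"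
    by (intro continuous_intros bounded_linear.continuous_on[OF matrix_vector_mul_bounded_linear])
  ultimately show ?thesis using open_vimage[OF assms(3)] by metis
qed

text \<open>The affine chart of the cone depends on which diagonal entry does not vanish.\<close>

lemma cone_chart:
  fixes l0 :: "real^3"
  assumes "l0 \<noteq> 0" "sdet l0 = 0"
  obtains P :: "real^3^3" and e W where "invertible P" "open W" "l0 \<in> W"
    "\<And>l. l \<in> W \<Longrightarrow> P *v l + e \<in> model_surface \<longleftrightarrow> sdet l = 0"
proof (cases "l0 $ 1 = 0")
  case False
  \<comment> \<open>Here \<open>(x, y, u) = (l $ 2, 1 - l $ 1, l $ 3)\<close>, so the denominator of
    the model is \<open>l $ 1\<close>.\<close>
  let ?P = "vector [vector [0, 1, 0], vector [-1, 0, 0], vector [0, 0, 1]] :: real^3^3"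
  let ?e = "vector [0, 1, 0] :: real^3"
  show ?thesis
  proof (rule that[of ?P "{l. l $ 1 \<noteq> 0}" ?e])
    show "invertible ?P" by (simp add: invertible_det_nz det_3 vector_3)
    show "open {l :: real^3. l $ 1 \<noteq> 0}" by (intro open_Collect_neq continuous_intros)
    show "l0 \<in> {l. l $ 1 \<noteq> 0}" using False by simp
    fix l :: "real^3" assume "l \<in> {l. l $ 1 \<noteq> 0}"
    then show "?P *v l + ?e \<in> model_surface \<longleftrightarrow> sdet l = 0"
      by (auto simp: model_surface_def matrix_vector_mult_def sum_3 vector_3 sdet_def field_simps)
  qed
next
  case True
  have 3: "l0 $ 3 \<noteq> 0"
  proof
    assume "l0 $ 3 = 0"
    with True assms(2) have "l0 $ 2 = 0" by (simp add: sdet_def)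
    with True \<open>l0 $ 3 = 0\<close> have "l0 = 0" by (simp add: vec_eq_iff forall_3)
    with assms(1) show False by simp
  qed
  \<comment> \<open>The diagonal entries exchange roles:
    \<open>(x, y, u) = (l $ 2, 1 - l $ 3, l $ 1)\<close>.\<close>
  let ?P = "vector [vector [0, 1, 0], vector [0, 0, -1], vector [1, 0, 0]] :: real^3^3"
  let ?e = "vector [0, 1, 0] :: real^3"
  show ?thesis
  proof (rule that[of ?P "{l. l $ 3 \<noteq> 0}" ?e])
    show "invertible ?P" by (simp add: invertible_det_nz det_3 vector_3)
    show "open {l :: real^3. l $ 3 \<noteq> 0}" by (intro open_Collect_neq continuous_intros)
    show "l0 \<in> {l. l $ 3 \<noteq> 0}" using 3 by simp
    fix l :: "real^3" assume "l \<in> {l. l $ 3 \<noteq> 0}"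
    then show "?P *v l + ?e \<in> model_surface \<longleftrightarrow> sdet l = 0"
      by (auto simp: model_surface_def matrix_vector_mult_def sum_3 vector_3 sdet_def field_simps)
  qed
qed

text \<open>The matrix entries \<open>(1 - \<zeta>, z, w)\<close> turn the model hypersurface into \<open>cone_tube\<close>.\<close>

definition to_cone :: "complex^3 \<Rightarrow> complex^3" where
  "to_cone q = vector [1 - q $ 2, q $ 1, q $ 3]"

definition from_cone :: "complex^3 \<Rightarrow> complex^3" where
  "from_cone Z = vector [Z $ 2, 1 - Z $ 1, Z $ 3]"

lemma from_to_cone [simp]: "from_cone (to_cone q) = q" "to_cone (from_cone Z) = Z"
  by (simp_all add: from_cone_def to_cone_def vec_eq_iff forall_3 vector_3)

lemma to_cone_iff: "to_cone q \<in> cone_tube \<longleftrightarrow> q \<in> model_hypersurface"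
  by (auto simp: to_cone_def cone_tube_def model_hypersurface_def vector_3 field_simps)

lemma holo_to_cone:
  assumes "\<And>k. holo (\<lambda>z. f z $ k) U"
  shows "holo (\<lambda>z. to_cone (f z) $ k) U"
  using exhaust_3[of k] by (auto simp: to_cone_def vector_3 intro!: holo_diff assms)

lemma holo_from_cone: "holo (\<lambda>z. from_cone z $ k) U"
  using exhaust_3[of k] by (auto simp: from_cone_def vector_3 intro!: holo_diff)

text \<open>A tube contains the real point \<open>cplx x\<close> over each \<open>x\<close> in its
  base, so restricting the straightened equivalence to real points gives a statement about
  \<open>S\<close> itself.\<close>

lemma tube_biholomorphic_imp_affine_at:
  assumes f: "biholomorphic3 U V f" and X: "openin (top_of_set (tube S)) X" "p \<in> X" "X \<subseteq> U"
    and fX: "openin (top_of_set model_hypersurface) (f ` X)" and p: "p = cplx x0"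
  shows "\<exists>X. openin (top_of_set S) X \<and> x0 \<in> X \<and> (\<exists>T\<in>Aff3. openin (top_of_set model_surface) (T ` X))"
proof -
  define g where "g = inv_into U f"
  have U: "open U" and V: "open V" and bij: "bij_betw f U V"
    and hf: "holomorphic3_on f U" and hg: "holomorphic3_on g V"
    using f by (auto simp: biholomorphic3_def g_def)
  have gf: "g (f z) = z" if "z \<in> U" for z using bij that by (simp add: g_def bij_betw_inv_into_left)
  have fg: "f (g w) = w" if "w \<in> V" for w using bij that by (simp add: g_def bij_betw_inv_into_right)
  have fV: "f z \<in> V" if "z \<in> U" for z using bij that by (auto simp: bij_betw_def)
  have gU: "g w \<in> U" if "w \<in> V" for w using bij_betw_inv_into[OF bij] that by (auto simp: g_def bij_betw_def)
  obtain O1 where O1: "open O1" "X = tube S \<inter> O1" using X(1) by (auto simp: openin_open)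
  obtain O2 where O2: "open O2" "f ` X = model_hypersurface \<inter> O2" using fX by (auto simp: openin_open)
  \<comment> \<open>Cutting down by both open witnesses turns the inclusion of images into an
    equivalence between lying in the tube and mapping into the model.\<close>
  define U' where "U' = (f -` O2 \<inter> U) \<inter> O1"
  have oU': "open U'"
    unfolding U'_def using continuous_on_open_vimage[OF U] holomorphic3_continuous_on[OF hf] O1 O2 by blast
  have U'U: "U' \<subseteq> U" by (auto simp: U'_def)
  have tube_iff: "z \<in> tube S \<longleftrightarrow> f z \<in> model_hypersurface" if z: "z \<in> U'" for z
  proof
    assume "z \<in> tube S"
    then have "z \<in> X" using z O1 by (auto simp: U'_def)
    then show "f z \<in> model_hypersurface" using O2 by blast
  next
    assume "f z \<in> model_hypersurface"
    then have "f z \<in> f ` X" using z O2 by (auto simp: U'_def)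
    then obtain z' where "z' \<in> X" "f z = f z'" by auto
    then have "z = z'" using gf[of z] gf[of z'] z X(3) U'U by auto
    then show "z \<in> tube S" using \<open>z' \<in> X\<close> O1 by auto
  qed
  have pU': "p \<in> U'" using X O1 O2 by (auto simp: U'_def)
  have pS: "p \<in> tube S" using X O1 by auto
  define F where "F z = to_cone (f z)" for z
  define h where "h Z = g (from_cone Z)" for Z
  define V1 where "V1 = from_cone -` V"
  have oV1: "open V1"
    unfolding V1_def by (rule open_vimage[OF V continuous_on_from_holo[OF holo_from_cone]])
  have h1: "holo (\<lambda>Z. h Z $ k) V1" for k
    unfolding h_def by (rule holo_compose[OF holo_component[OF hg] holo_from_cone]) (simp add: V1_def)
  define V' where "V' = h -` U' \<inter> V1"
  have oV': "open V'"
    unfolding V'_def using continuous_on_open_vimage[OF oV1] continuous_on_from_holo[OF h1] oU' by blast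
  have hF: "h (F z) = z" if "z \<in> U'" for z using gf that U'U by (auto simp: h_def F_def)
  have Fh: "F (h Z) = Z" if "Z \<in> V'" for Z using fg that by (auto simp: h_def F_def V'_def V1_def)
  have FV': "F z \<in> V'" if "z \<in> U'" for z
    using hF[OF that] that fV U'U by (auto simp: V'_def V1_def F_def)
  have hU': "h Z \<in> U'" if "Z \<in> V'" for Z using that by (auto simp: V'_def)
  have F: "holo (\<lambda>z. F z $ k) U'" for k
    unfolding F_def by (rule holo_to_cone[OF holo_subset[OF holo_component[OF hf] U'U]])
  have h: "holo (\<lambda>Z. h Z $ k) V'" for k
    by (rule holo_subset[OF h1]) (auto simp: V'_def)
  have cone_iff: "z \<in> tube S \<longleftrightarrow> F z \<in> cone_tube" if "z \<in> U'" for z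
    using tube_iff[OF that] by (simp add: F_def to_cone_iff)
  have inv: "\<forall>\<^sub>F s::real in nhds 0. F (z + axis b (\<i> * of_real s)) \<in> cone_tube"
    if z: "z \<in> U'" "F z \<in> cone_tube" for z b
  proof -
    have "continuous_on UNIV (\<lambda>s::real. z + axis b (\<i> * of_real s))" by (intro continuous_intros)
    from open_vimage[OF oU' this] have "\<forall>\<^sub>F s::real in nhds 0. z + axis b (\<i> * of_real s) \<in> U'"
      using z by (auto simp: eventually_nhds axis_def zero_vec_def[symmetric] intro!: exI[of _ "(\<lambda>s::real. z + axis b (\<i> * of_real s)) -` U'"])
    then show ?thesis
    proof eventually_elim
      case (elim s)
      have "re (z + axis b (\<i> * of_real s)) = re z"
        by (simp add: re_def vec_eq_iff axis_def)
      then show ?case using cone_iff[OF elim] cone_iff[OF z(1)] z(2) by (simp add: tube_re)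
    qed
  qed
  obtain A :: "real^3^3" and c r where A: "invertible A" and r: "r > 0" "ball p r \<subseteq> U'"
    and Ac: "\<And>z. z \<in> ball p r \<Longrightarrow> sdet (A *v re z + c) = 0 \<longleftrightarrow> sdet (re (F z)) = 0"
    and Ac0: "\<And>z i. z \<in> ball p r \<Longrightarrow> A *v re z + c = 0 \<Longrightarrow> Re (F z $ i) = 0"
    apply (rule cone_tube_straightening[OF oU' oV' F h FV' hU' hF Fh pU' _ inv, folded re_def]; assumption?)
    using cone_iff[OF pU'] pS apply simp
    subgoal premises prems by (rule prems(1)[OF prems(2-6)])
    done
  have pcone: "F p \<in> cone_tube" using cone_iff[OF pU'] pS by simp
  have rex0: "re p = x0" by (simp add: p)
  \<comment> \<open>\<open>cone_chart\<close> excludes the zero matrix; here it would force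
    \<open>Re (F p $ 1) = 0\<close>, against \<open>pcone\<close>.\<close>
  have l0: "A *v x0 + c \<noteq> 0"
    using Ac0[of p 1] r pcone rex0 by (auto simp: cone_tube_def)
  have "sdet (re (F p)) = 0" using pcone by (simp add: sdet_def re_def cone_tube_def)
  then have l0': "sdet (A *v x0 + c) = 0" using Ac[of p] r rex0 by simp
  obtain P :: "real^3^3" and e W where P: "invertible P" and W: "open W" "A *v x0 + c \<in> W"
    and PW: "\<And>l. l \<in> W \<Longrightarrow> P *v l + e \<in> model_surface \<longleftrightarrow> sdet l = 0"
    using cone_chart[OF l0 l0'] by metis
  \<comment> \<open>Where this entry is nonzero, membership in \<open>cone_tube\<close> reduces to
    the vanishing of \<open>sdet\<close>.\<close>
  define B where "B = {z \<in> ball p r. Re (F z $ 1) \<noteq> 0}"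
  have oB: "open B"
  proof -
    have "continuous_on (ball p r) (\<lambda>z. Re (F z $ 1))"
      by (intro continuous_intros continuous_on_subset[OF holo_continuous_on[OF F] r(2)])
    then have "open ((\<lambda>z. Re (F z $ 1)) -` (- {0}) \<inter> ball p r)"
      by (subst (asm) continuous_on_open_vimage[OF open_ball]) auto
    then show ?thesis unfolding B_def by (simp add: vimage_def Int_def conj_commute)
  qed
  define Q where "Q = (cplx -` B) \<inter> ((\<lambda>x. A *v x + c) -` W)"
  have oQ: "open Q"
    unfolding Q_def
    by (intro open_Int open_vimage oB W continuous_cplx continuous_intros
        bounded_linear.continuous_on[OF matrix_vector_mul_bounded_linear])
  have x0Q: "x0 \<in> Q" using W r pcone by (auto simp: Q_def B_def cone_tube_def p)
  define T where "T x = (P ** A) *v x + (P *v c + e)" for x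
  have T: "T x = P *v (A *v x + c) + e" for x
    by (simp add: T_def matrix_vector_mul_assoc matrix_vector_right_distrib)
  have PA: "invertible (P ** A)" using P A by (rule invertible_mult)
  have TQ: "x \<in> S \<longleftrightarrow> T x \<in> model_surface" if x: "x \<in> Q" for x
  proof -
    have b: "cplx x \<in> ball p r" "Re (F (cplx x) $ 1) \<noteq> 0" and W': "A *v x + c \<in> W"
      using x by (auto simp: Q_def B_def)
    have "x \<in> S \<longleftrightarrow> cplx x \<in> tube S" by (simp add: tube_re)
    also have "\<dots> \<longleftrightarrow> F (cplx x) \<in> cone_tube" using b r by (intro cone_iff) auto
    also have "\<dots> \<longleftrightarrow> sdet (re (F (cplx x))) = 0" using b(2) by (simp add: cone_tube_def sdet_def re_def)
    also have "\<dots> \<longleftrightarrow> T x \<in> model_surface" unfolding T PW[OF W'] using Ac[OF b(1)] by simp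
    finally show ?thesis .
  qed
  have "T \<in> Aff3" unfolding Aff3_def T_def[abs_def] using PA by blast
  moreover have "openin (top_of_set model_surface) (T ` (S \<inter> Q))"
  proof -
    obtain A' where "(P ** A) ** A' = mat 1" "A' ** (P ** A) = mat 1" using PA by (auto simp: invertible_def)
    from open_affine_image[OF this oQ] have "open (T ` Q)" unfolding T_def[abs_def] .
    moreover have "T ` (S \<inter> Q) = model_surface \<inter> T ` Q" using TQ by auto
    ultimately show ?thesis by (auto simp: openin_open)
  qed
  moreover have "openin (top_of_set S) (S \<inter> Q)" using oQ by (auto simp: openin_open)
  moreover have "x0 \<in> S \<inter> Q" using x0Q pS by (simp add: tube_re p)
  ultimately show ?thesis by blast
qed

theorem theorem1p5:
  fixes S :: "(real^3) set" and M :: "(complex^3) set"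
  assumes "nondegenerate_analytic_surface S"
    and "M = tube S"
  shows "locally_equivalent affine_transformations S model_surface \<longleftrightarrow>
         locally_equivalent local_biholomorphisms M model_hypersurface"
proof
  assume "locally_equivalent affine_transformations S model_surface"
  then show "locally_equivalent local_biholomorphisms M model_hypersurface"
    unfolding assms(2) model_hypersurface_tube by (rule affine_equivalent_imp_tubes_biholomorphic)
next
  assume eq: "locally_equivalent local_biholomorphisms M model_hypersurface"
  show "locally_equivalent affine_transformations S model_surface"
    unfolding locally_equivalent_def
  proof
    fix x0 assume "x0 \<in> S"
    then have "cplx x0 \<in> M" by (simp add: assms(2) tube_re)
    then obtain X U f where "openin (top_of_set (tube S)) X" "cplx x0 \<in> X" "(U, f) \<in> local_biholomorphisms"
      "X \<subseteq> U" "openin (top_of_set model_hypersurface) (f ` X)"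
      using eq unfolding locally_equivalent_def assms(2) by fastforce
    moreover from this obtain V where "biholomorphic3 U V f" by (auto simp: local_biholomorphisms_def)
    ultimately obtain X T where "openin (top_of_set S) X" "x0 \<in> X" "T \<in> Aff3" "openin (top_of_set model_surface) (T ` X)"
      using tube_biholomorphic_imp_affine_at[of U V f S X "cplx x0" x0] by blast
    then show "\<exists>X. openin (top_of_set S) X \<and> x0 \<in> X \<and>
        (\<exists>(U, f)\<in>affine_transformations. X \<subseteq> U \<and> openin (top_of_set model_surface) (f ` X))"
      by (intro exI[of _ X] conjI bexI[of _ "(UNIV, T)"]) (auto simp: affine_transformations_def)
  qed
qed

end
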